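(* Let $G$ be a connected finite simple graph on the vertex set $[n]$. Then $\Omega(\mathcal{P}_G,\mathcal{P}_G)$ is normal if and only if $G$ does not contain two odd cycles having no common vertex.
   Context: A finite simple graph is a finite graph with no loops, no multiple edges and no isolated vertices. The edge polytope $\mathcal{P}_G\subset\mathbb{R}^n$ is the convex hull of all $\mathbf{e}_i+\mathbf{e}_j$ with $\{i,j\}$ an edge of $G$. For a lattice polytope $\mathcal{P}\subset\mathbb{R}^n$, $\Omega(\mathcal{P},\mathcal{P})=\mathrm{conv}\{(\mathcal{P}\times\{1\}) \cup (-\mathcal{P}\times\{-1\})\}\subset \mathbb{R}^{n+1}$. Two lattice polytopes are unimodularly equivalent if there is an affine map between their affine spans that maps the lattice points of one affine span bijectively onto those of the other and maps one polytope onto the other. A lattice polytope $\mathcal{P}$ of dimension $k$ is normal if, for a full-dimensional unimodularly equivalent copy $\mathcal{Q}\subset\mathbb{R}^k$ of $\mathcal{P}$ (such that every lattice point of $\mathbb{Z}^k$ is an affine integer combination of lattice points of $\mathcal{Q}$), for every positive integer $N$ and every $\mathbf{x}\in N\mathcal{Q}\cap\mathbb{Z}^k$ there exist $\mathbf{x}_1,\ldots,\mathbf{x}_N\in\mathcal{Q}\cap\mathbb{Z}^k$ with $\mathbf{x}=\mathbf{x}_1+\cdots+\mathbf{x}_N$, where $N\mathcal{Q}=\{N\mathbf{a}\mid \mathbf{a}\in\mathcal{Q}\}$. *)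

theory Defs
  imports "HOL-Analysis.Analysis" "Graph_Theory.Graph_Theory"
begin

text \<open>
  An edge between \<open>i\<close> and \<open>j\<close> is the pair of arcs \<open>(i, j)\<close>, \<open>(j, i)\<close>; \<open>pair_graph\<close> says that the
  set of arcs is finite, symmetric and free of loops.
\<close>

definition finite_simple_graph :: "'a pair_pre_digraph \<Rightarrow> bool" where
  "finite_simple_graph G \<longleftrightarrow>
     pair_graph G \<and> (\<forall>v \<in> pverts G. \<exists>w. (v, w) \<in> parcs G)"

text \<open>
  The directed cycles of a symmetric digraph are the cycles of the underlying graph, traversed in
  one of the two directions, together with the back-and-forth walks along a single edge. The latter
  have length 2, so they do not occur among the cycles of odd length.
\<close>

definition odd_cycle :: "'a pair_pre_digraph \<Rightarrow> ('a \<times> 'a) list \<Rightarrow> bool" where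
  "odd_cycle G p \<longleftrightarrow> pre_digraph.cycle (with_proj G) p \<and> odd (length p)"

text \<open>A cycle visits exactly the tails of its arcs.\<close>

definition cycle_verts :: "('a \<times> 'a) list \<Rightarrow> 'a set" where
  "cycle_verts p = fst ` set p"

definition edge_polytope :: "'n::finite pair_pre_digraph \<Rightarrow> (real ^ 'n) set" where
  "edge_polytope G = convex hull {axis i 1 + axis j 1 | i j. (i, j) \<in> parcs G}"

definition Omega_polytope :: "'a::euclidean_space set \<Rightarrow> 'a set \<Rightarrow> ('a \<times> real) set" where
  "Omega_polytope P Q = convex hull (P \<times> {1} \<union> uminus ` Q \<times> {-1})"

definition int_lattice :: "'a::euclidean_space set" where
  "int_lattice = {x. \<forall>b \<in> Basis. x \<bullet> b \<in> \<int>}"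

text \<open>
  An affine map between affine subspaces is the restriction of a map \<open>x \<mapsto> g x + c\<close> with
  \<open>g\<close> linear on the ambient space.
\<close>

definition unimodularly_equivalent :: "'a::euclidean_space set \<Rightarrow> 'b::euclidean_space set \<Rightarrow> bool" where
  "unimodularly_equivalent P Q \<longleftrightarrow>
     (\<exists>g c. linear g \<and>
        bij_betw (\<lambda>x. g x + c) (affine hull P \<inter> int_lattice) (affine hull Q \<inter> int_lattice) \<and>
        (\<lambda>x. g x + c) ` P = Q)"

definition affine_int_combinations :: "'a::real_vector set \<Rightarrow> 'a set" where
  "affine_int_combinations A =
     {\<Sum>a\<in>S. of_int (c a) *\<^sub>R a | S (c :: 'a \<Rightarrow> int). finite S \<and> S \<subseteq> A \<and> sum c S = 1}"

text \<open>
  For a lattice polytope \<open>P\<close> of dimension \<open>k\<close>. The space \<open>\<real>\<^sup>k\<close> that contains the full-dimensional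
  copy \<open>Q\<close> is represented by a coordinate subspace \<open>span B\<close> with \<open>B \<subseteq> Basis\<close> of the ambient space,
  with \<open>\<int>\<^sup>k\<close> represented by \<open>span B \<inter> int_lattice\<close>. Such a \<open>B\<close> with \<open>card B = k\<close> exists because
  \<open>k\<close> is at most the dimension of the ambient space, and \<open>affine hull Q = span B\<close> forces
  \<open>card B = k\<close>.
\<close>

definition normal_polytope :: "'a::euclidean_space set \<Rightarrow> bool" where
  "normal_polytope P \<longleftrightarrow>
     (\<exists>B Q. B \<subseteq> Basis \<and> affine hull Q = span B \<and> unimodularly_equivalent P Q \<and>
        span B \<inter> int_lattice \<subseteq> affine_int_combinations (Q \<inter> int_lattice) \<and>
        (\<forall>N::nat. N > 0 \<longrightarrow>
           (\<forall>x \<in> (\<lambda>a. real N *\<^sub>R a) ` Q \<inter> (span B \<inter> int_lattice).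
              \<exists>y :: nat \<Rightarrow> 'a. (\<forall>i<N. y i \<in> Q \<inter> int_lattice) \<and> x = (\<Sum>i<N. y i))))"

end

theory Submission
  imports Defs
begin

text \<open>
  The lattice points of \<open>\<Omega>(\<P>\<^sub>G, \<P>\<^sub>G)\<close> are \<open>0\<close> and the vectors \<open>\<plusminus>(\<^bold>e\<^sub>i + \<^bold>e\<^sub>j, 1)\<close>. If \<open>C\<close> and \<open>C'\<close>
  are disjoint odd cycles, half the difference of the sums of their edge vectors is a lattice point
  of the dilation by \<open>N = (|C| + |C'|) / 2\<close>. Its \<open>\<ell>\<^sup>1\<close>-norm is the largest one that \<open>N\<close> of these
  vectors can reach, so a decomposition into \<open>N\<close> of them admits no cancellation and contains a
  perfect matching of the odd set \<open>C\<close>.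

  Conversely, without two disjoint odd cycles, an integral combination of linearly independent edge
  vectors has integral coefficients. Every point of \<open>N \<Omega>\<close> is a combination of edge vectors of
  \<open>\<ell>\<^sup>1\<close>-norm at most \<open>N\<close> in which those with fractional coefficients are independent.
\<close>

section \<open>Lattice points and bounded integral coefficients\<close>

lemma int_lattice_0 [simp]: "0 \<in> int_lattice"
  and int_lattice_add: "x \<in> int_lattice \<Longrightarrow> y \<in> int_lattice \<Longrightarrow> x + y \<in> int_lattice"
  and int_lattice_diff: "x \<in> int_lattice \<Longrightarrow> y \<in> int_lattice \<Longrightarrow> x - y \<in> int_lattice"
  and int_lattice_scaleR: "r \<in> \<int> \<Longrightarrow> x \<in> int_lattice \<Longrightarrow> r *\<^sub>R x \<in> int_lattice"
  and Basis_subset_int_lattice: "Basis \<subseteq> int_lattice"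
  by (auto simp: int_lattice_def inner_add_left inner_diff_left inner_Basis)

lemma int_lattice_minus: "x \<in> int_lattice \<Longrightarrow> - x \<in> int_lattice"
  using int_lattice_diff[of 0 x] by simp

lemma int_lattice_sum: "(\<And>i. i \<in> I \<Longrightarrow> f i \<in> int_lattice) \<Longrightarrow> sum f I \<in> int_lattice"
  by (induction I rule: infinite_finite_induct) (auto intro: int_lattice_add)

lemma int_lattice_prod_iff:
  "(x :: (real ^ 'n::finite) \<times> real) \<in> int_lattice \<longleftrightarrow> (\<forall>w. fst x $ w \<in> \<int>) \<and> snd x \<in> \<int>"
  by (cases x) (auto simp: int_lattice_def Basis_prod_def Basis_vec_def inner_axis)

lemma span_Basis_subset_expansion:
  fixes z :: "'a::euclidean_space"
  assumes "B \<subseteq> Basis" "z \<in> span B"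
  shows "(\<Sum>b\<in>B. (z \<bullet> b) *\<^sub>R b) = z"
proof -
  have "(\<Sum>b\<in>B. (z \<bullet> b) *\<^sub>R b) = (\<Sum>b\<in>Basis. (z \<bullet> b) *\<^sub>R b)"
    using assms span_substd_basis[OF assms(1)]
    by (intro sum.mono_neutral_left) auto
  then show ?thesis by (simp add: euclidean_representation)
qed

text \<open>The closed unit interval around a non-integer does not have 0 in its interior, so the
  absolute value is linear on it with slope \<open>sgn c\<close>. This makes the l1-norm linear
  along the moves below.\<close>

lemma abs_eq_if_between_floor_ceiling:
  fixes c x :: real
  assumes "c \<notin> \<int>" "of_int \<lfloor>c\<rfloor> \<le> x" "x \<le> of_int \<lceil>c\<rceil>"
  shows "\<bar>x\<bar> = sgn c * x"
proof (cases "c > 0")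
  case True
  then have "0 \<le> \<lfloor>c\<rfloor>" by simp
  then have "0 \<le> x" using assms(2) by linarith
  then show ?thesis using True by simp
next
  case False
  moreover have "c \<noteq> 0" using assms(1) by auto
  ultimately have "c < 0" by simp
  then have "\<lceil>c\<rceil> \<le> 0" by (simp add: ceiling_le_iff)
  then have "x \<le> 0" using assms(3) by linarith
  then show ?thesis using \<open>c < 0\<close> by simp
qed

text \<open>
  Moving the coefficients along a linear relation among the vectors with fractional coefficients,
  in the direction that does not increase the \<open>\<ell>\<^sup>1\<close>-norm (which is linear until a coefficient
  becomes an integer), reduces the number of fractional coefficients.
\<close>

lemma exists_fewer_fractional_coeffs:
  fixes E :: "'a::real_vector set" and c :: "'a \<Rightarrow> real"
  assumes "finite E" and dep: "dependent {e \<in> E. c e \<notin> \<int>}"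
  shows "\<exists>c'. (\<Sum>e\<in>E. c' e *\<^sub>R e) = (\<Sum>e\<in>E. c e *\<^sub>R e) \<and> (\<Sum>e\<in>E. \<bar>c' e\<bar>) \<le> (\<Sum>e\<in>E. \<bar>c e\<bar>) \<and>
    {e \<in> E. c' e \<notin> \<int>} \<subset> {e \<in> E. c e \<notin> \<int>}"
proof -
  let ?F = "{e \<in> E. c e \<notin> \<int>}"
  have finF: "finite ?F" using assms(1) by simp
  obtain d0 v0 where d0: "v0 \<in> ?F" "d0 v0 \<noteq> 0" "(\<Sum>v\<in>?F. d0 v *\<^sub>R v) = 0"
    using dep unfolding dependent_finite[OF finF] by blast
  \<comment> \<open>With the right sign the relation becomes a direction along which the initial
    slope of the l1-norm is at most 0.\<close>
  define r :: real where "r = (if (\<Sum>v\<in>?F. sgn (c v) * d0 v) \<le> 0 then 1 else -1)"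
  define d where "d v = (if v \<in> ?F then r * d0 v else 0)" for v
  have d_out: "d v = 0" if "v \<notin> ?F" for v using that by (auto simp: d_def)
  have dv0: "d v0 \<noteq> 0" using d0 by (auto simp: d_def r_def)
  have "(\<Sum>v\<in>E. d v *\<^sub>R v) = (\<Sum>v\<in>?F. d v *\<^sub>R v)"
    using assms(1) d_out by (intro sum.mono_neutral_right) auto
  also have "\<dots> = r *\<^sub>R (\<Sum>v\<in>?F. d0 v *\<^sub>R v)"
    unfolding scaleR_sum_right by (intro sum.cong) (auto simp: d_def)
  finally have d_rel: "(\<Sum>v\<in>E. d v *\<^sub>R v) = 0" using d0(3) by simp
  have "(\<Sum>v\<in>?F. sgn (c v) * d v) = r * (\<Sum>v\<in>?F. sgn (c v) * d0 v)"
    unfolding sum_distrib_left by (intro sum.cong) (auto simp: d_def)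
  then have slope: "(\<Sum>v\<in>?F. sgn (c v) * d v) \<le> 0" by (auto simp: r_def)
  define S where "S = {v \<in> ?F. d v \<noteq> 0}"
  have S: "finite S" "v0 \<in> S" using assms(1) d0 dv0 by (auto simp: S_def)
  \<comment> \<open>\<open>\<tau> v\<close> is the time at which the coefficient of \<open>v\<close>
    reaches the next integer in its direction of motion. The motion stops at the first such
    time.\<close>
  define \<tau> where "\<tau> v =
    (if d v > 0 then (of_int \<lceil>c v\<rceil> - c v) / d v else (of_int \<lfloor>c v\<rfloor> - c v) / d v)" for v
  define t where "t = Min (\<tau> ` S)"
  have "t \<in> \<tau> ` S" unfolding t_def using S by (intro Min_in) auto
  then obtain v1 where v1: "v1 \<in> S" "t = \<tau> v1" by auto
  have t_le: "t \<le> \<tau> v" if "v \<in> S" for v unfolding t_def using S that by auto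
  have \<tau>_nonneg: "\<tau> v \<ge> 0" for v
    unfolding \<tau>_def by (auto simp: divide_nonneg_pos intro!: divide_nonpos_nonpos)
  have "t \<ge> 0" using v1 \<tau>_nonneg by simp
  define c' where "c' v = c v + t * d v" for v
  have between: "of_int \<lfloor>c v\<rfloor> \<le> c' v \<and> c' v \<le> of_int \<lceil>c v\<rceil>" if "v \<in> ?F" for v
  proof -
    have fc: "of_int \<lfloor>c v\<rfloor> \<le> c v" "c v \<le> of_int \<lceil>c v\<rceil>" by auto
    consider "d v = 0" | "d v > 0" | "d v < 0" by linarith
    then show ?thesis
    proof cases
      case 1
      then show ?thesis using fc by (simp add: c'_def)
    next
      case 2
      then have "t \<le> (of_int \<lceil>c v\<rceil> - c v) / d v" using t_le[of v] that by (simp add: S_def \<tau>_def)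
      then have "t * d v \<le> of_int \<lceil>c v\<rceil> - c v" using 2 by (simp add: pos_le_divide_eq)
      moreover have "0 \<le> t * d v" using \<open>t \<ge> 0\<close> 2 by simp
      ultimately show ?thesis unfolding c'_def using fc by linarith
    next
      case 3
      then have "t \<le> (of_int \<lfloor>c v\<rfloor> - c v) / d v" using t_le[of v] that by (simp add: S_def \<tau>_def)
      then have "of_int \<lfloor>c v\<rfloor> - c v \<le> t * d v" using 3 by (simp add: neg_le_divide_eq)
      moreover have "t * d v \<le> 0" using \<open>t \<ge> 0\<close> 3 by (simp add: mult_nonneg_nonpos)
      ultimately show ?thesis unfolding c'_def using fc by linarith
    qed
  qed
  have "(\<Sum>v\<in>E. c' v *\<^sub>R v) = (\<Sum>v\<in>E. c v *\<^sub>R v) + t *\<^sub>R (\<Sum>v\<in>E. d v *\<^sub>R v)"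
    by (simp add: c'_def scaleR_add_left sum.distrib scaleR_sum_right)
  then have "(\<Sum>v\<in>E. c' v *\<^sub>R v) = (\<Sum>v\<in>E. c v *\<^sub>R v)" using d_rel by simp
  moreover have "(\<Sum>v\<in>E. \<bar>c' v\<bar>) \<le> (\<Sum>v\<in>E. \<bar>c v\<bar>)"
  proof -
    have "\<bar>c' v\<bar> = \<bar>c v\<bar> + t * (sgn (c v) * d v)" if "v \<in> E" for v
    proof (cases "v \<in> ?F")
      case True
      then have "\<bar>c' v\<bar> = sgn (c v) * c' v"
        using abs_eq_if_between_floor_ceiling between[OF True] by auto
      then show ?thesis by (simp add: c'_def abs_sgn algebra_simps)
    next
      case False
      then show ?thesis using d_out by (simp add: c'_def)
    qed
    then have "(\<Sum>v\<in>E. \<bar>c' v\<bar>) = (\<Sum>v\<in>E. \<bar>c v\<bar>) + t * (\<Sum>v\<in>E. sgn (c v) * d v)"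
      by (simp add: sum.distrib sum_distrib_left)
    also have "(\<Sum>v\<in>E. sgn (c v) * d v) = (\<Sum>v\<in>?F. sgn (c v) * d v)"
      using assms(1) d_out by (intro sum.mono_neutral_right) auto
    finally show ?thesis using slope \<open>t \<ge> 0\<close> by (simp add: mult_nonneg_nonpos)
  qed
  moreover have "{e \<in> E. c' e \<notin> \<int>} \<subset> ?F"
  proof (rule psubsetI)
    show "{e \<in> E. c' e \<notin> \<int>} \<subseteq> ?F"
    proof
      fix e assume e: "e \<in> {e \<in> E. c' e \<notin> \<int>}"
      show "e \<in> ?F"
      proof (rule ccontr)
        assume "e \<notin> ?F"
        then show False using e d_out[of e] by (auto simp: c'_def)
      qed
    qed
    have "c' v1 = of_int \<lceil>c v1\<rceil> \<or> c' v1 = of_int \<lfloor>c v1\<rfloor>"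
      using v1 by (simp add: c'_def \<tau>_def S_def)
    then have "c' v1 \<in> \<int>" by auto
    moreover have "v1 \<in> ?F" using v1 by (simp add: S_def)
    ultimately show "{e \<in> E. c' e \<notin> \<int>} \<noteq> ?F" by blast
  qed
  ultimately show ?thesis by blast
qed

text \<open>A Caratheodory-type reduction. Only the vectors with fractional coefficients are made
  independent, as integral multiples can later be split off as lattice points.\<close>

lemma exists_independent_fractional_coeffs:
  fixes E :: "'a::real_vector set" and c :: "'a \<Rightarrow> real"
  assumes "finite E"
  shows "\<exists>c'. (\<Sum>e\<in>E. c' e *\<^sub>R e) = (\<Sum>e\<in>E. c e *\<^sub>R e) \<and> (\<Sum>e\<in>E. \<bar>c' e\<bar>) \<le> (\<Sum>e\<in>E. \<bar>c e\<bar>) \<and>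
    independent {e \<in> E. c' e \<notin> \<int>}"
proof (induction "card {e \<in> E. c e \<notin> \<int>}" arbitrary: c rule: less_induct)
  case less
  show ?case
  proof (cases "independent {e \<in> E. c e \<notin> \<int>}")
    case True
    then show ?thesis by blast
  next
    case False
    then have "dependent {e \<in> E. c e \<notin> \<int>}" by simp
    from exists_fewer_fractional_coeffs[OF assms this] obtain c' where
      c': "(\<Sum>e\<in>E. c' e *\<^sub>R e) = (\<Sum>e\<in>E. c e *\<^sub>R e)" "(\<Sum>e\<in>E. \<bar>c' e\<bar>) \<le> (\<Sum>e\<in>E. \<bar>c e\<bar>)"
      "{e \<in> E. c' e \<notin> \<int>} \<subset> {e \<in> E. c e \<notin> \<int>}" by blast
    have "card {e \<in> E. c' e \<notin> \<int>} < card {e \<in> E. c e \<notin> \<int>}"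
      using assms by (intro psubset_card_mono[OF _ c'(3)]) simp
    from less[OF this] obtain c'' where
      "(\<Sum>e\<in>E. c'' e *\<^sub>R e) = (\<Sum>e\<in>E. c' e *\<^sub>R e)" "(\<Sum>e\<in>E. \<bar>c'' e\<bar>) \<le> (\<Sum>e\<in>E. \<bar>c' e\<bar>)"
      "independent {e \<in> E. c'' e \<notin> \<int>}" by blast
    with c' show ?thesis by (intro exI[of _ c'']) auto
  qed
qed

text \<open>Each summand moves one nonzero coefficient by 1 towards 0, which lowers the l1-norm by
  1. Once all coefficients vanish, the remaining summands are 0.\<close>

lemma signed_sum_of_bounded_int_coeffs:
  fixes E :: "'a::real_vector set" and c :: "'a \<Rightarrow> int"
  assumes "finite E" "(\<Sum>e\<in>E. \<bar>c e\<bar>) \<le> int N"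
  shows "\<exists>y. (\<forall>i<N. y i \<in> insert 0 (E \<union> uminus ` E)) \<and> (\<Sum>e\<in>E. of_int (c e) *\<^sub>R e) = (\<Sum>i<N. y i)"
  using assms(2)
proof (induction N arbitrary: c)
  case 0
  then have "(\<Sum>e\<in>E. \<bar>c e\<bar>) = 0" by (intro antisym sum_nonneg) auto
  then have "\<forall>e\<in>E. c e = 0" using assms(1) by (simp add: sum_nonneg_eq_0_iff)
  then show ?case by simp
next
  case (Suc N)
  show ?case
  proof (cases "\<forall>e\<in>E. c e = 0")
    case True
    then show ?thesis by (intro exI[of _ "\<lambda>_. 0"]) simp
  next
    case False
    then obtain e where e: "e \<in> E" "c e \<noteq> 0" by auto
    define c' where "c' = c(e := c e - sgn (c e))"
    have "(\<Sum>e\<in>E. \<bar>c' e\<bar>) = (\<Sum>e\<in>E. \<bar>c e\<bar>) - 1"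
      using assms(1) e by (simp add: sum.remove[of E e] c'_def sgn_if)
    then have "(\<Sum>e\<in>E. \<bar>c' e\<bar>) \<le> int N" using Suc.prems by simp
    from Suc.IH[OF this] obtain y where y: "\<forall>i<N. y i \<in> insert 0 (E \<union> uminus ` E)"
      "(\<Sum>e\<in>E. of_int (c' e) *\<^sub>R e) = (\<Sum>i<N. y i)" by blast
    define z where "z = of_int (sgn (c e)) *\<^sub>R e"
    have "z \<in> E \<union> uminus ` E" using e by (auto simp: z_def sgn_if)
    moreover have "(\<Sum>e\<in>E. of_int (c e) *\<^sub>R e) = (\<Sum>e\<in>E. of_int (c' e) *\<^sub>R e) + z"
      using assms(1) e by (simp add: sum.remove[of E e] c'_def z_def algebra_simps)
    ultimately show ?thesis
      using y by (intro exI[of _ "y(N := z)"]) (auto simp: less_Suc_eq)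
  qed
qed

section \<open>Normality of centrally symmetric hulls\<close>

lemma convex_hull_Un_uminus_eq:
  fixes E :: "'a::real_vector set"
  assumes "finite E" "E \<noteq> {}"
  shows "convex hull (E \<union> uminus ` E) = {\<Sum>e\<in>E. c e *\<^sub>R e | c. (\<Sum>e\<in>E. \<bar>c e\<bar>) \<le> 1}"
    (is "?H = ?T")
proof
  show "?H \<subseteq> ?T"
  proof (rule hull_minimal)
    show "E \<union> uminus ` E \<subseteq> ?T"
    proof
      fix x assume "x \<in> E \<union> uminus ` E"
      then obtain e s where e: "e \<in> E" "x = s *\<^sub>R e" "\<bar>s\<bar> = 1"
        by (metis Un_iff abs_1 abs_minus_cancel imageE scaleR_minus1_left scaleR_one)
      have "x = (\<Sum>v\<in>E. (if v = e then s else 0) *\<^sub>R v)"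
        using e assms(1) by (simp add: if_distrib[of "\<lambda>r. r *\<^sub>R _"] cong: if_cong)
      moreover have "(\<Sum>v\<in>E. \<bar>if v = e then s else 0\<bar>) = 1"
        using e assms(1) by (simp add: if_distrib[of abs] cong: if_cong)
      ultimately show "x \<in> ?T" by (intro CollectI exI[of _ "\<lambda>v. if v = e then s else 0"]) simp
    qed
    show "convex ?T"
    proof (rule convexI)
      fix x y u v assume "x \<in> ?T" "y \<in> ?T" and uv: "0 \<le> u" "0 \<le> v" "u + v = (1::real)"
      then obtain a b where a: "x = (\<Sum>e\<in>E. a e *\<^sub>R e)" "(\<Sum>e\<in>E. \<bar>a e\<bar>) \<le> 1"
        and b: "y = (\<Sum>e\<in>E. b e *\<^sub>R e)" "(\<Sum>e\<in>E. \<bar>b e\<bar>) \<le> 1" by auto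
      have "(\<Sum>e\<in>E. \<bar>u * a e + v * b e\<bar>) \<le> (\<Sum>e\<in>E. u * \<bar>a e\<bar> + v * \<bar>b e\<bar>)"
        by (intro sum_mono) (use uv in \<open>simp add: abs_mult abs_triangle_ineq[THEN order_trans]\<close>)
      also have "\<dots> = u * (\<Sum>e\<in>E. \<bar>a e\<bar>) + v * (\<Sum>e\<in>E. \<bar>b e\<bar>)"
        by (simp add: sum.distrib sum_distrib_left)
      also have "\<dots> \<le> 1" using convex_bound_le[OF a(2) b(2) uv] .
      finally have "(\<Sum>e\<in>E. \<bar>u * a e + v * b e\<bar>) \<le> 1" .
      moreover have "u *\<^sub>R x + v *\<^sub>R y = (\<Sum>e\<in>E. (u * a e + v * b e) *\<^sub>R e)"
        by (simp add: a b scaleR_sum_right sum.distrib scaleR_add_left)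
      ultimately show "u *\<^sub>R x + v *\<^sub>R y \<in> ?T"
        by (intro CollectI exI[of _ "\<lambda>e. u * a e + v * b e"] conjI)
    qed
  qed
  have gen: "e \<in> ?H" "- e \<in> ?H" if "e \<in> E" for e
    using that by (auto intro: hull_inc)
  obtain e0 where "e0 \<in> E" using assms(2) by auto
  then have "(1/2) *\<^sub>R e0 + (1/2) *\<^sub>R (- e0) \<in> ?H"
    using gen by (intro convexD[OF convex_convex_hull]) auto
  then have zero: "0 \<in> ?H" by simp
  show "?T \<subseteq> ?H"
  proof
    fix x assume "x \<in> ?T"
    then obtain c where c: "x = (\<Sum>e\<in>E. c e *\<^sub>R e)" "(\<Sum>e\<in>E. \<bar>c e\<bar>) \<le> 1" by auto
    define s where "s = (\<Sum>e\<in>E. \<bar>c e\<bar>)"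
    have "s \<ge> 0" by (simp add: s_def sum_nonneg)
    show "x \<in> ?H"
    proof (cases "s = 0")
      case True
      then have "\<forall>e\<in>E. c e = 0" using assms(1) by (simp add: s_def sum_nonneg_eq_0_iff)
      then show ?thesis using c zero by simp
    next
      case False
      have "(\<Sum>e\<in>E. (\<bar>c e\<bar> / s) *\<^sub>R (sgn (c e) *\<^sub>R e)) \<in> ?H"
      proof (rule convex_sum[OF assms(1) convex_convex_hull])
        show "(\<Sum>e\<in>E. \<bar>c e\<bar> / s) = 1" using False by (simp add: s_def flip: sum_divide_distrib)
        show "sgn (c e) *\<^sub>R e \<in> ?H" if "e \<in> E" for e
          using gen[OF that] zero by (auto simp: sgn_if)
      qed (use \<open>s \<ge> 0\<close> in auto)
      then have "s *\<^sub>R (\<Sum>e\<in>E. (\<bar>c e\<bar> / s) *\<^sub>R (sgn (c e) *\<^sub>R e)) + (1 - s) *\<^sub>R 0 \<in> ?H"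
        using c \<open>s \<ge> 0\<close> zero by (intro convexD[OF convex_convex_hull]) (auto simp: s_def)
      moreover have "s *\<^sub>R (\<Sum>e\<in>E. (\<bar>c e\<bar> / s) *\<^sub>R (sgn (c e) *\<^sub>R e)) = x"
        unfolding c scaleR_sum_right using False
        by (intro sum.cong) (auto simp: abs_mult_sgn)
      ultimately show ?thesis by simp
    qed
  qed
qed

lemma zero_in_convex_hull_Un_uminus:
  fixes E :: "'a::real_vector set"
  assumes "finite E" "E \<noteq> {}"
  shows "0 \<in> convex hull (E \<union> uminus ` E)"
  unfolding convex_hull_Un_uminus_eq[OF assms] by (auto intro!: exI[of _ "\<lambda>_. 0"])

lemma affine_hull_convex_hull_Un_uminus:
  fixes E :: "'a::euclidean_space set"
  assumes "finite E" "E \<noteq> {}"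
  shows "affine hull (convex hull (E \<union> uminus ` E)) = span E"
proof -
  have "0 \<in> affine hull (E \<union> uminus ` E)"
    using zero_in_convex_hull_Un_uminus[OF assms] convex_hull_subset_affine_hull by blast
  then have "affine hull (E \<union> uminus ` E) = span (E \<union> uminus ` E)" by (rule affine_hull_span_0)
  also have "\<dots> = span E"
    unfolding span_eq by (auto intro: span_base span_neg)
  finally show ?thesis by simp
qed

text \<open>Unimodularity makes a maximal independent \<open>F \<subseteq> E\<close> a lattice basis
  of \<open>span E\<close>, so sending \<open>F\<close> to standard basis vectors \<open>B\<close>
  gives a full-dimensional copy. It also shows that, once the fractional coefficients of a lattice
  point are carried by independent vectors, there are none left.\<close>

lemma normal_polytope_if_unimodular:
  fixes E :: "'a::euclidean_space set"
  assumes "finite E" "E \<noteq> {}" "E \<subseteq> int_lattice"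
    and unimodular: "\<And>F c f. F \<subseteq> E \<Longrightarrow> independent F \<Longrightarrow> (\<Sum>f\<in>F. c f *\<^sub>R f) \<in> int_lattice \<Longrightarrow>
      f \<in> F \<Longrightarrow> c f \<in> \<int>"
  shows "normal_polytope (convex hull (E \<union> uminus ` E))"
proof -
  let ?\<Omega> = "convex hull (E \<union> uminus ` E)"
  have zero: "0 \<in> ?\<Omega>" using zero_in_convex_hull_Un_uminus assms(1,2) .
  have \<Omega>: "?\<Omega> = {\<Sum>e\<in>E. c e *\<^sub>R e | c. (\<Sum>e\<in>E. \<bar>c e\<bar>) \<le> 1}"
    using convex_hull_Un_uminus_eq[OF assms(1,2)] .
  obtain F where F: "F \<subseteq> E" "independent F" "E \<subseteq> span F"
    using maximal_independent_subset[of E] by metis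
  have finF: "finite F" using F(1) assms(1) finite_subset by blast
  have spanF: "span F = span E" using F by (metis span_eq span_superset subset_trans)
  have aff: "affine hull ?\<Omega> = span F"
    using affine_hull_convex_hull_Un_uminus[OF assms(1,2)] spanF by simp
  have card_le: "card F \<le> card (Basis :: 'a set)"
    using independent_bound[OF F(2)] by simp
  obtain B :: "'a set" where B: "B \<subseteq> Basis" "card B = card F" "finite B"
    by (rule obtain_subset_with_card_n[OF card_le])
  obtain \<beta> where \<beta>: "bij_betw \<beta> F B"
    using finite_same_card_bij[OF finF B(3)] B(2) by auto
  have indepB: "independent B" using B(1) independent_Basis independent_mono by blast
  obtain g where g: "linear g" "\<And>f. f \<in> F \<Longrightarrow> g f = \<beta> f"
    using linear_independent_extend[OF F(2), of \<beta>] by blast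
  obtain h where h: "linear h" "\<And>b. b \<in> B \<Longrightarrow> h b = the_inv_into F \<beta> b"
    using linear_independent_extend[OF indepB, of "the_inv_into F \<beta>"] by blast
  have inj\<beta>: "inj_on \<beta> F" and im\<beta>: "\<beta> ` F = B" using \<beta> by (auto simp: bij_betw_def)
  have hg: "h (g x) = x" if "x \<in> span F" for x
  proof (rule linear_eq_on_span[OF _ _ _ that])
    show "linear (\<lambda>x. h (g x))" using linear_compose[OF g(1) h(1)] by (simp add: comp_def)
    show "h (g x) = x" if "x \<in> F" for x
      using that g(2) h(2) im\<beta> by (auto simp: the_inv_into_f_f[OF inj\<beta>])
  qed (rule linear_ident)
  have gh: "g (h z) = z" if "z \<in> span B" for z
  proof (rule linear_eq_on_span[OF _ _ _ that])
    show "linear (\<lambda>x. g (h x))" using linear_compose[OF h(1) g(1)] by (simp add: comp_def)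
    show "g (h x) = x" if "x \<in> B" for x
      using that g(2) h(2) im\<beta> f_the_inv_into_f[OF inj\<beta>] the_inv_into_into[OF inj\<beta>, of x F] by auto
  qed (rule linear_ident)
  have gF: "g ` F = B" using g(2) im\<beta> by auto
  have g_span: "g ` span F = span B" using linear_span_image[OF g(1), of F] gF by simp
  have h_span: "h z \<in> span F" if "z \<in> span B" for z
    using that hg unfolding g_span[symmetric] by auto
  have g_int: "g x \<in> int_lattice" if x_lattice: "x \<in> span F \<inter> int_lattice" for x
  proof -
    obtain c where x: "x = (\<Sum>f\<in>F. c f *\<^sub>R f)"
      using x_lattice by (auto simp: span_finite[OF finF])
    have "c f \<in> \<int>" if "f \<in> F" for f
      using unimodular[OF F(1,2) _ that] x_lattice x by simp
    moreover have "g x = (\<Sum>f\<in>F. c f *\<^sub>R g f)"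
      by (simp add: x linear_sum[OF g(1)] linear_cmul[OF g(1)])
    moreover have "g f \<in> int_lattice" if "f \<in> F" for f
      using that gF B(1) Basis_subset_int_lattice by blast
    ultimately show ?thesis by (auto intro!: int_lattice_sum int_lattice_scaleR)
  qed
  have h_int: "h z \<in> int_lattice" if "z \<in> span B \<inter> int_lattice" for z
  proof -
    have "h z = h (\<Sum>b\<in>B. (z \<bullet> b) *\<^sub>R b)"
      using that span_Basis_subset_expansion[OF B(1)] by simp
    also have "\<dots> = (\<Sum>b\<in>B. (z \<bullet> b) *\<^sub>R h b)"
      by (simp add: linear_sum[OF h(1)] linear_cmul[OF h(1)])
    also have "\<dots> \<in> int_lattice"
    proof (intro int_lattice_sum int_lattice_scaleR)
      fix b assume b: "b \<in> B"
      show "z \<bullet> b \<in> \<int>" using that b B(1) by (auto simp: int_lattice_def)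
      have "h b \<in> F" using b h(2) im\<beta> the_inv_into_into[OF inj\<beta>, of b F] by auto
      then show "h b \<in> int_lattice" using F(1) assms(3) by auto
    qed
    finally show ?thesis .
  qed
  define Q where "Q = g ` ?\<Omega>"
  have affQ: "affine hull Q = span B"
    using affine_hull_linear_image[of g ?\<Omega>] g(1) aff g_span
    by (simp only: Q_def linear_conv_bounded_linear)
  have BQ: "insert 0 B \<subseteq> Q \<inter> int_lattice"
  proof -
    have "0 \<in> Q" using zero linear_0[OF g(1)] unfolding Q_def by force
    moreover have "F \<subseteq> ?\<Omega>" using F(1) by (auto intro: hull_inc)
    then have "B \<subseteq> Q" using gF unfolding Q_def by auto
    ultimately show ?thesis using B(1) Basis_subset_int_lattice by auto
  qed
  have "bij_betw (\<lambda>x. g x + 0) (affine hull ?\<Omega> \<inter> int_lattice) (affine hull Q \<inter> int_lattice)"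
    unfolding aff affQ
    by (rule bij_betw_byWitness[where f' = h])
      (use hg gh g_int h_int h_span g_span in auto)
  then have "unimodularly_equivalent ?\<Omega> Q"
    unfolding unimodularly_equivalent_def using g(1) Q_def
    by (intro exI[of _ g] exI[of _ 0]) auto
  moreover have "span B \<inter> int_lattice \<subseteq> affine_int_combinations (Q \<inter> int_lattice)"
  proof
    fix z assume z: "z \<in> span B \<inter> int_lattice"
    \<comment> \<open>The vector 0 absorbs the weight missing to 1 without changing the sum.\<close>
    define a where "a b = (if b = 0 then 1 - (\<Sum>b\<in>B. \<lfloor>z \<bullet> b\<rfloor>) else \<lfloor>z \<bullet> b\<rfloor>)" for b
    have "0 \<notin> B" using B(1) by (auto dest: nonzero_Basis)
    have a: "a b = \<lfloor>z \<bullet> b\<rfloor>" "of_int (a b) = z \<bullet> b" if "b \<in> B" for b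
    proof -
      show "a b = \<lfloor>z \<bullet> b\<rfloor>" using that \<open>0 \<notin> B\<close> by (auto simp: a_def)
      moreover have "z \<bullet> b \<in> \<int>" using z that B(1) by (auto simp: int_lattice_def)
      ultimately show "of_int (a b) = z \<bullet> b" by simp
    qed
    have "sum a (insert 0 B) = 1"
      using \<open>0 \<notin> B\<close> B(3) a(1) by (simp add: a_def[of 0])
    moreover have "(\<Sum>b\<in>insert 0 B. of_int (a b) *\<^sub>R b) = z"
      using \<open>0 \<notin> B\<close> B(3) a(2) span_Basis_subset_expansion[OF B(1)] z by simp
    ultimately show "z \<in> affine_int_combinations (Q \<inter> int_lattice)"
      unfolding affine_int_combinations_def using BQ B(3)
      by (intro CollectI exI[of _ "insert 0 B"] exI[of _ a]) auto
  qed
  moreover have "\<exists>y :: nat \<Rightarrow> 'a. (\<forall>i<N. y i \<in> Q \<inter> int_lattice) \<and> x = (\<Sum>i<N. y i)"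
    if x: "x \<in> (\<lambda>a. real N *\<^sub>R a) ` Q \<inter> (span B \<inter> int_lattice)" for N x
  proof -
    obtain \<omega> where \<omega>: "\<omega> \<in> ?\<Omega>" "x = real N *\<^sub>R g \<omega>" using x by (auto simp: Q_def)
    then have gx: "x = g (real N *\<^sub>R \<omega>)" by (simp add: linear_cmul[OF g(1)])
    have "\<omega> \<in> span F" using \<omega>(1) aff hull_subset[of ?\<Omega> affine] by auto
    then have "h x = real N *\<^sub>R \<omega>" unfolding gx by (intro hg span_mul)
    then have int: "real N *\<^sub>R \<omega> \<in> int_lattice" using h_int[of x] x by auto
    obtain c where c: "\<omega> = (\<Sum>e\<in>E. c e *\<^sub>R e)" "(\<Sum>e\<in>E. \<bar>c e\<bar>) \<le> 1" using \<omega>(1) \<Omega> by auto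
    obtain c' where c': "(\<Sum>e\<in>E. c' e *\<^sub>R e) = (\<Sum>e\<in>E. (real N * c e) *\<^sub>R e)"
      "(\<Sum>e\<in>E. \<bar>c' e\<bar>) \<le> (\<Sum>e\<in>E. \<bar>real N * c e\<bar>)" "independent {e \<in> E. c' e \<notin> \<int>}"
      using exists_independent_fractional_coeffs[OF assms(1), of "\<lambda>e. real N * c e"] by blast
    have sum_c': "(\<Sum>e\<in>E. c' e *\<^sub>R e) = real N *\<^sub>R \<omega>"
      using c'(1) by (simp add: c scaleR_sum_right)
    have "(\<Sum>e\<in>E. \<bar>real N * c e\<bar>) = real N * (\<Sum>e\<in>E. \<bar>c e\<bar>)"
      by (simp add: abs_mult sum_distrib_left)
    also have "\<dots> \<le> real N" using c(2) by (simp add: mult_left_le)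
    finally have norm_c': "(\<Sum>e\<in>E. \<bar>c' e\<bar>) \<le> real N" using c'(2) by linarith
    let ?F' = "{e \<in> E. c' e \<notin> \<int>}"
    \<comment> \<open>Subtracting the integral multiples leaves a lattice point, so unimodularity
      applies to the independent set \<open>?F'\<close> and shows that it is empty.\<close>
    have "(\<Sum>e\<in>?F'. c' e *\<^sub>R e) = (\<Sum>e\<in>E. c' e *\<^sub>R e) - (\<Sum>e\<in>E - ?F'. c' e *\<^sub>R e)"
      using assms(1) by (subst sum.subset_diff[of ?F' E]) auto
    also have "\<dots> \<in> int_lattice"
      unfolding sum_c' using assms(3)
      by (intro int_lattice_diff int int_lattice_sum int_lattice_scaleR) auto
    finally have F'_int: "(\<Sum>e\<in>?F'. c' e *\<^sub>R e) \<in> int_lattice" .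
    have c'_int: "c' e \<in> \<int>" if "e \<in> E" for e
      using unimodular[OF _ c'(3) F'_int, of e] that by blast
    then have floor: "of_int \<lfloor>c' e\<rfloor> = c' e" if "e \<in> E" for e using that by simp
    have "real_of_int (\<Sum>e\<in>E. \<bar>\<lfloor>c' e\<rfloor>\<bar>) = (\<Sum>e\<in>E. \<bar>c' e\<bar>)" by (simp add: floor)
    then have "(\<Sum>e\<in>E. \<bar>\<lfloor>c' e\<rfloor>\<bar>) \<le> int N" using norm_c' by linarith
    from signed_sum_of_bounded_int_coeffs[OF assms(1) this] obtain y where
      y: "\<forall>i<N. y i \<in> insert 0 (E \<union> uminus ` E)" "(\<Sum>e\<in>E. of_int \<lfloor>c' e\<rfloor> *\<^sub>R e) = (\<Sum>i<N. y i)"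
      by blast
    have "real N *\<^sub>R \<omega> = (\<Sum>i<N. y i)" using y(2) sum_c' by (simp add: floor)
    then have "x = (\<Sum>i<N. g (y i))" by (simp add: gx linear_sum[OF g(1)])
    moreover have "g (y i) \<in> Q \<inter> int_lattice" if "i < N" for i
    proof -
      have yi: "y i \<in> insert 0 (E \<union> uminus ` E)" using y(1) that by simp
      then have "y i \<in> ?\<Omega>" using zero by (auto intro: hull_inc)
      moreover have "y i \<in> int_lattice" using yi assms(3) by (auto intro!: int_lattice_minus)
      moreover have "?\<Omega> \<subseteq> span F" using aff hull_subset[of ?\<Omega> affine] by simp
      ultimately show ?thesis using g_int unfolding Q_def by blast
    qed
    ultimately show ?thesis by (intro exI[of _ "\<lambda>i. g (y i)"]) blast
  qed
  ultimately show ?thesis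
    unfolding normal_polytope_def using B(1) affQ by blast
qed

section \<open>Integer decompositions pulled back from a normal copy\<close>

text \<open>Normality speaks of some copy \<open>Q\<close>, so decompositions have to be carried
  back along the equivalence \<open>g x + t\<close>. As the image of 0, \<open>t\<close> is a
  lattice point, hence the linear part \<open>g\<close> preserves lattice points as well.\<close>

lemma integer_decomposition_if_normal:
  fixes E :: "'a::euclidean_space set"
  assumes "finite E" "E \<noteq> {}" "E \<subseteq> int_lattice"
    and normal: "normal_polytope (convex hull (E \<union> uminus ` E))"
    and "N > 0" and \<omega>: "\<omega> \<in> convex hull (E \<union> uminus ` E)" and int: "real N *\<^sub>R \<omega> \<in> int_lattice"
  shows "\<exists>p. (\<forall>i<N. p i \<in> convex hull (E \<union> uminus ` E) \<inter> int_lattice) \<and> real N *\<^sub>R \<omega> = (\<Sum>i<N. p i)"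
proof -
  let ?\<Omega> = "convex hull (E \<union> uminus ` E)"
  have zero: "0 \<in> ?\<Omega>" using zero_in_convex_hull_Un_uminus assms(1,2) .
  have aff: "affine hull ?\<Omega> = span E" using affine_hull_convex_hull_Un_uminus[OF assms(1,2)] .
  have \<Omega>_span: "?\<Omega> \<subseteq> span E" using aff hull_subset[of ?\<Omega> affine] by simp
  obtain B Q where B: "B \<subseteq> Basis" and affQ: "affine hull Q = span B"
    and equiv: "unimodularly_equivalent ?\<Omega> Q"
    and idp: "\<forall>N>0. \<forall>x \<in> (\<lambda>a. real N *\<^sub>R a) ` Q \<inter> (span B \<inter> int_lattice).
      \<exists>y :: nat \<Rightarrow> 'a. (\<forall>i<N. y i \<in> Q \<inter> int_lattice) \<and> x = (\<Sum>i<N. y i)"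
    using normal unfolding normal_polytope_def by (elim exE conjE) (rule that)
  obtain g t where g: "linear g" and Q: "(\<lambda>x. g x + t) ` ?\<Omega> = Q"
    and bij: "bij_betw (\<lambda>x. g x + t) (span E \<inter> int_lattice) (span B \<inter> int_lattice)"
    using equiv unfolding unimodularly_equivalent_def aff affQ by (elim exE conjE) (rule that)
  have into: "g x + t \<in> span B \<inter> int_lattice" if "x \<in> span E \<inter> int_lattice" for x
    using bij that by (auto simp: bij_betw_def)
  have "0 \<in> span E \<inter> int_lattice" by (simp add: span_0)
  from into[OF this] have t: "t \<in> span B \<inter> int_lattice" by (simp add: linear_0[OF g])
  have g_into: "g x \<in> span B \<inter> int_lattice" if "x \<in> span E \<inter> int_lattice" for x
    using into[OF that] t span_diff[of "g x + t" B t] int_lattice_diff[of "g x + t" t] by auto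
  have inj: "x = y" if "x \<in> span E \<inter> int_lattice" "y \<in> span E \<inter> int_lattice" "g x = g y" for x y
    using inj_onD[OF bij_betw_imp_inj_on[OF bij], of x y] that by simp
  \<comment> \<open>Surjectivity is applied to \<open>b + t\<close>, because the bijection is
    \<open>g x + t\<close> rather than \<open>g\<close>.\<close>
  have "\<exists>m. m \<in> span E \<inter> int_lattice \<and> g m = b" if "b \<in> B" for b
  proof -
    have "b \<in> int_lattice" using that B Basis_subset_int_lattice by blast
    then have "b + t \<in> span B \<inter> int_lattice"
      using t that by (auto intro: span_add span_base int_lattice_add)
    then show ?thesis using bij unfolding bij_betw_def by (force simp: image_iff)
  qed
  then obtain m where m: "\<And>b. b \<in> B \<Longrightarrow> m b \<in> span E \<inter> int_lattice \<and> g (m b) = b" by metis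
  text \<open>A priori the linear part is injective only on lattice points. Its inverse there is the
    restriction of a linear map, which makes it injective on the whole span.\<close>
  define h where "h z = (\<Sum>b\<in>B. (z \<bullet> b) *\<^sub>R m b)" for z
  have h: "linear h"
    unfolding h_def
    by (rule linearI) (simp_all add: inner_add_left scaleR_add_left sum.distrib scaleR_sum_right)
  have gh: "g (h z) = z" if "z \<in> span B" for z
  proof -
    have "g (h z) = (\<Sum>b\<in>B. (z \<bullet> b) *\<^sub>R b)"
      using m by (simp add: h_def linear_sum[OF g] linear_cmul[OF g])
    then show ?thesis using span_Basis_subset_expansion[OF B that] by simp
  qed
  have "h (g e) = e" if "e \<in> E" for e
  proof -
    have e: "e \<in> span E \<inter> int_lattice" using that assms(3) by (auto intro: span_base)
    note ge = g_into[OF e]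
    have "g e \<bullet> b \<in> \<int>" if "b \<in> B" for b using ge that B by (auto simp: int_lattice_def)
    then have "h (g e) \<in> span E \<inter> int_lattice"
      unfolding h_def using m
      by (auto intro!: span_sum span_mul int_lattice_sum int_lattice_scaleR)
    then show ?thesis using inj[OF _ e] gh ge by auto
  qed
  then have hg: "h (g x) = x" if "x \<in> span E" for x
    using linear_eq_on_span[OF linear_compose[OF g h] linear_ident, of E x] that
    by (simp add: comp_def)
  have x: "real N *\<^sub>R \<omega> \<in> span E \<inter> int_lattice"
    using int \<omega> \<Omega>_span by (auto intro: span_mul)
  \<comment> \<open>Dilation by \<open>N\<close> turns the translation into \<open>N\<close> copies
    of \<open>t\<close>, one for each of the \<open>N\<close> summands found in
    \<open>Q\<close>.\<close>
  have "real N *\<^sub>R (g \<omega> + t) = g (real N *\<^sub>R \<omega>) + real N *\<^sub>R t"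
    by (simp add: scaleR_add_right linear_cmul[OF g])
  also have "\<dots> \<in> span B \<inter> int_lattice"
    using g_into[OF x] t by (auto intro!: span_add span_mul int_lattice_add int_lattice_scaleR)
  finally have "real N *\<^sub>R (g \<omega> + t) \<in> (\<lambda>a. real N *\<^sub>R a) ` Q \<inter> (span B \<inter> int_lattice)"
    using \<omega> Q by auto
  from idp[rule_format, OF \<open>N > 0\<close> this] obtain y where y: "\<And>i. i < N \<Longrightarrow> y i \<in> Q \<inter> int_lattice"
    "real N *\<^sub>R (g \<omega> + t) = (\<Sum>i<N. y i)" by blast
  have "\<exists>p. p \<in> ?\<Omega> \<inter> int_lattice \<and> y i = g p + t" if i: "i < N" for i
  proof -
    obtain p where p: "p \<in> ?\<Omega>" "y i = g p + t" using y(1)[OF i] Q by auto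
    have "y i \<in> span B \<inter> int_lattice" using y(1)[OF i] affQ hull_subset[of Q affine] by auto
    then obtain p' where p': "p' \<in> span E \<inter> int_lattice" "y i = g p' + t"
      using bij unfolding bij_betw_def by (force simp: image_iff)
    \<comment> \<open>\<open>p\<close> is known to lie in the polytope and \<open>p'\<close> in the
      lattice. Injectivity on the whole span identifies them.\<close>
    have "p = p'" using p p' hg[of p] hg[of p'] \<Omega>_span by auto
    then show ?thesis using p p' by auto
  qed
  then obtain p where p: "\<And>i. i < N \<Longrightarrow> p i \<in> ?\<Omega> \<inter> int_lattice \<and> y i = g (p i) + t" by metis
  have "g (real N *\<^sub>R \<omega>) + real N *\<^sub>R t = (\<Sum>i<N. g (p i) + t)"
    using y(2) p by (simp add: scaleR_add_right linear_cmul[OF g])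
  also have "\<dots> = g (\<Sum>i<N. p i) + real N *\<^sub>R t"
    by (simp add: sum.distrib linear_sum[OF g] sum_constant_scaleR)
  finally have "g (real N *\<^sub>R \<omega>) = g (\<Sum>i<N. p i)" by simp
  moreover have "(\<Sum>i<N. p i) \<in> span E" using p \<Omega>_span by (intro span_sum) blast
  ultimately have "real N *\<^sub>R \<omega> = (\<Sum>i<N. p i)" using hg x by (metis IntD1)
  then show ?thesis using p by blast
qed

section \<open>Edge vectors and cycles\<close>

text \<open>Both arcs of an edge have the same vector, so a sum over the image of the arcs counts
  each edge once.\<close>

definition edge_vec :: "'n::finite \<Rightarrow> 'n \<Rightarrow> (real ^ 'n) \<times> real" where
  "edge_vec i j = (axis i 1 + axis j 1, 1)"

lemma edge_vec_commute: "edge_vec i j = edge_vec j i"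
  by (simp add: edge_vec_def add.commute)

lemma fst_edge_vec_nth: "fst (edge_vec i j) $ w = (if i = w then 1 else 0) + (if j = w then 1 else 0)"
  by (auto simp: edge_vec_def axis_def)

lemma edge_vec_eq_iff:
  assumes "i \<noteq> j" "k \<noteq> l"
  shows "edge_vec i j = edge_vec k l \<longleftrightarrow> i = k \<and> j = l \<or> i = l \<and> j = k"
proof
  assume "edge_vec i j = edge_vec k l"
  then have *: "fst (edge_vec i j) $ w = fst (edge_vec k l) $ w" for w by simp
  show "i = k \<and> j = l \<or> i = l \<and> j = k"
    using *[of i] *[of j] *[of k] *[of l] assms unfolding fst_edge_vec_nth
    by (auto split: if_splits)
qed (auto simp: edge_vec_commute)

text \<open>An arbitrary arc set \<open>D\<close> lets the notion be used for the subgraph of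
  fractional edges. The repeated vertex \<open>f m = f 0\<close> keeps indices free of remainders,
  and \<open>3 \<le> m\<close> rules out walking back and forth along one edge.\<close>

definition simple_cycle :: "('n \<times> 'n) set \<Rightarrow> nat \<Rightarrow> (nat \<Rightarrow> 'n) \<Rightarrow> bool" where
  "simple_cycle D m f \<longleftrightarrow>
     3 \<le> m \<and> inj_on f {..<m} \<and> f m = f 0 \<and> (\<forall>i<m. (f i, f (Suc i)) \<in> D)"

lemma simple_cycle_mono: "simple_cycle D m f \<Longrightarrow> D \<subseteq> E \<Longrightarrow> simple_cycle E m f"
  by (auto simp: simple_cycle_def)

text \<open>Close up a longest path at its last vertex.\<close>

lemma simple_cycle_exists:
  fixes D :: "('n::finite \<times> 'n) set"
  assumes "D \<noteq> {}" "irrefl D"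
    and step: "\<And>u w. (u, w) \<in> D \<Longrightarrow> \<exists>j. j \<noteq> u \<and> (w, j) \<in> D"
  shows "\<exists>m f. simple_cycle D m f"
proof -
  define P where "P k \<longleftrightarrow> (\<exists>f. inj_on f {..k} \<and> (\<forall>i<k. (f i, f (Suc i)) \<in> D))" for k
  obtain a b where ab: "(a, b) \<in> D" using assms(1) by auto
  have "a \<noteq> b" using ab assms(2) by (auto simp: irrefl_def)
  have bound: "k \<le> CARD('n)" if "P k" for k
  proof -
    from that obtain f :: "nat \<Rightarrow> 'n" where "inj_on f {..k}" by (auto simp: P_def)
    then have "card (f ` {..k}) = Suc k" by (simp add: card_image)
    moreover have "card (f ` {..k}) \<le> CARD('n)" by (rule card_mono) auto
    ultimately show ?thesis by simp
  qed
  have P1: "P 1"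
    unfolding P_def
    by (rule exI[of _ "\<lambda>i. if i = 0 then a else b"])
      (use ab \<open>a \<noteq> b\<close> in \<open>auto simp: inj_on_def le_Suc_eq\<close>)
  define k where "k = Greatest P"
  have Pk: "P k" unfolding k_def by (rule GreatestI_nat[of P 1, OF P1]) (use bound in auto)
  have k_max: "k' \<le> k" if "P k'" for k'
    unfolding k_def by (rule Greatest_le_nat[of P k', OF that]) (use bound in auto)
  have "k \<ge> 1" using k_max[OF P1] .
  from Pk obtain f where f: "inj_on f {..k}" "\<And>i. i < k \<Longrightarrow> (f i, f (Suc i)) \<in> D"
    by (auto simp: P_def)
  obtain k' where k': "k = Suc k'" using \<open>k \<ge> 1\<close> by (cases k) auto
  obtain j where j: "j \<noteq> f k'" "(f k, j) \<in> D" using step[of "f k'" "f k"] f(2)[of k'] k' by auto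
  have "j \<in> f ` {..k}"
  proof (rule ccontr)
    assume nj: "j \<notin> f ` {..k}"
    have "inj_on (f(Suc k := j)) {..Suc k}"
      using f(1) nj unfolding inj_on_def by (auto simp: le_Suc_eq image_iff)
    moreover have "\<forall>i<Suc k. ((f(Suc k := j)) i, (f(Suc k := j)) (Suc i)) \<in> D"
      using f(2) j by (auto simp: less_Suc_eq)
    ultimately have "P (Suc k)" unfolding P_def by blast
    then show False using k_max[of "Suc k"] by simp
  qed
  then obtain i where i: "i \<le> k" "j = f i" by auto
  have "i \<noteq> k" using j(2) i assms(2) by (auto simp: irrefl_def)
  \<comment> \<open>The new neighbour differs from the predecessor of the last vertex, so the cycle
    has length at least 3.\<close>
  moreover have "i \<noteq> k'" using j i by auto
  ultimately have ik: "i < k'" using i k' by auto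
  define g where "g t = (if t = Suc k - i then f i else f (i + t))" for t
  have "simple_cycle D (Suc k - i) g"
    unfolding simple_cycle_def
  proof (intro conjI allI impI)
    show "3 \<le> Suc k - i" using ik k' by simp
    show "inj_on g {..<Suc k - i}"
    proof (rule inj_onI)
      fix s t assume "s \<in> {..<Suc k - i}" "t \<in> {..<Suc k - i}" "g s = g t"
      then show "s = t" using inj_onD[OF f(1), of "i + s" "i + t"] by (simp add: g_def)
    qed
    show "g (Suc k - i) = g 0" using ik by (simp add: g_def)
    fix t assume t: "t < Suc k - i"
    show "(g t, g (Suc t)) \<in> D"
    proof (cases "Suc t = Suc k - i")
      case True
      then have "i + t = k" using ik k' by simp
      then show ?thesis using j i t True by (auto simp: g_def)
    next
      case False
      then show ?thesis using f(2)[of "i + t"] t by (auto simp: g_def)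
    qed
  qed
  then show ?thesis by blast
qed

lemma odd_cycle_of_simple_cycle:
  assumes "simple_cycle (parcs G) m f" "odd m" "pair_graph G"
  shows "\<exists>p. odd_cycle G p \<and> cycle_verts p = f ` {..<m}"
proof -
  interpret pair_graph G by fact
  define arc where "arc i = (f i, f (Suc i))" for i
  let ?p = "map arc [0..<m]"
  have m: "3 \<le> m" and inj: "inj_on f {..<m}" and closed: "f m = f 0"
    and arcs: "\<And>i. i < m \<Longrightarrow> arc i \<in> parcs G"
    using assms(1) by (auto simp: simple_cycle_def arc_def)
  have cas: "pcas (f a) (map arc [a..<b]) (f b)" if "a \<le> b" for a b
    using that
  proof (induction "b - a" arbitrary: a)
    case (Suc d)
    then have "pcas (f (Suc a)) (map arc [Suc a..<b]) (f b)" by simp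
    then show ?case using Suc(2) by (simp add: upt_conv_Cons arc_def)
  qed simp
  have cas': "pcas (f 0) ?p (f 0)" using cas[of 0 m] closed by simp
  have tl: "tl (pawalk_verts (f 0) ?p) = map (f \<circ> Suc) [0..<m]"
    using awalk_verts_conv'[OF cas'] m by (auto simp: arc_def)
  \<comment> \<open>A library cycle requires its vertex list without the first entry to be distinct.
    That list is \<open>f 1, ..., f m\<close>, a rotation of
    \<open>f 0, ..., f (m - 1)\<close>.\<close>
  have "inj_on (f \<circ> Suc) {0..<m}"
  proof (rule inj_onI)
    fix i j assume ij: "i \<in> {0..<m}" "j \<in> {0..<m}" "(f \<circ> Suc) i = (f \<circ> Suc) j"
    have *: "f (Suc i) = f (if Suc i = m then 0 else Suc i)" for i using closed by simp
    have "(if Suc i = m then 0 else Suc i) = (if Suc j = m then 0 else Suc j)"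
      using inj_onD[OF inj, of "if Suc i = m then 0 else Suc i" "if Suc j = m then 0 else Suc j"]
        ij * by simp
    then show "i = j" by (auto split: if_splits)
  qed
  then have "distinct (map (f \<circ> Suc) [0..<m])" by (simp add: distinct_map)
  moreover have "f 0 \<in> pverts G" using arcs[of 0] m by (auto simp: arc_def dest: in_arcsD1)
  moreover have "set ?p \<subseteq> parcs G" using arcs by auto
  moreover have "?p \<noteq> []" using m by simp
  ultimately have "cycle ?p"
    unfolding cycle_def awalk_def using cas' tl by metis
  then have "odd_cycle G ?p" unfolding odd_cycle_def using assms(2) by simp
  moreover have "cycle_verts ?p = f ` {..<m}"
    by (force simp: cycle_verts_def arc_def image_image)
  ultimately show ?thesis by blast
qed

text \<open>Two positions with the same edge either start at the same vertex or traverse the edge in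
  opposite directions. The latter is possible only in a cycle of length 2; the cases differ in where
  the index wraps around.\<close>

lemma inj_on_cycle_edges:
  assumes "simple_cycle D m f" "irrefl D"
  shows "inj_on (\<lambda>i. edge_vec (f i) (f (Suc i))) {..<m}"
proof (rule inj_onI)
  fix i j assume ij: "i \<in> {..<m}" "j \<in> {..<m}"
    and eq: "edge_vec (f i) (f (Suc i)) = edge_vec (f j) (f (Suc j))"
  have m: "3 \<le> m" and inj: "\<And>i j. i < m \<Longrightarrow> j < m \<Longrightarrow> f i = f j \<Longrightarrow> i = j" and closed: "f m = f 0"
    using assms(1) by (auto simp: simple_cycle_def inj_on_def)
  have "f i \<noteq> f (Suc i)" if "i < m" for i
    using assms that by (auto simp: simple_cycle_def irrefl_def)
  then have "f i = f j \<or> f i = f (Suc j) \<and> f (Suc i) = f j"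
    using edge_vec_eq_iff[of "f i" "f (Suc i)" "f j" "f (Suc j)"] ij eq by auto
  then show "i = j"
  proof
    assume "f i = f j" then show ?thesis using inj ij by auto
  next
    assume *: "f i = f (Suc j) \<and> f (Suc i) = f j"
    consider "Suc j < m" "Suc i < m" | "Suc j = m" | "Suc i = m" using ij by fastforce
    then show ?thesis
    proof cases
      case 1 then show ?thesis using inj[of i "Suc j"] inj[of "Suc i" j] * ij by auto
    next
      case 2
      then have "i = 0" using inj[of i 0] * ij closed m by auto
      then have "j = 1" using inj[of "Suc i" j] * ij m by auto
      then show ?thesis using 2 m by simp
    next
      case 3
      then have "j = 0" using inj[of j 0] * ij closed m by auto
      then have "i = 1" using inj[of i "Suc j"] * ij m by auto
      then show ?thesis using 3 m by simp
    qed
  qed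
qed

text \<open>Around a cycle of even length the alternating sum of the edge vectors vanishes.\<close>

lemma odd_length_if_independent:
  fixes D :: "('n::finite \<times> 'n) set"
  assumes "simple_cycle D m f" "irrefl D" "independent (case_prod edge_vec ` D)"
  shows "odd m"
proof
  assume "even m"
  let ?g = "\<lambda>i. edge_vec (f i) (f (Suc i))"
  \<comment> \<open>The height 1 of an edge is shared equally by its two ends, so each signed edge
    vector is a difference of consecutive \<open>?b\<close> and the sum telescopes.\<close>
  let ?b = "\<lambda>i. (-1) ^ i *\<^sub>R (axis (f i) 1, 1/2) :: (real ^ 'n) \<times> real"
  have m: "3 \<le> m" and closed: "f m = f 0" and arcs: "\<And>i. i < m \<Longrightarrow> (f i, f (Suc i)) \<in> D"
    using assms(1) by (auto simp: simple_cycle_def)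
  note inj = inj_on_cycle_edges[OF assms(1,2)]
  define u where "u e = (-1 :: real) ^ (the_inv_into {..<m} ?g e)" for e
  have "(\<Sum>e\<in>?g ` {..<m}. u e *\<^sub>R e) = (\<Sum>i<m. (-1) ^ i *\<^sub>R ?g i)"
    by (subst sum.reindex[OF inj]) (auto simp: u_def the_inv_into_f_f[OF inj])
  also have "\<dots> = (\<Sum>i<m. ?b i - ?b (Suc i))"
    by (intro sum.cong refl) (simp add: edge_vec_def scaleR_add_right)
  also have "\<dots> = ?b 0 - ?b m" by (rule sum_lessThan_telescope')
  also have "\<dots> = 0" using \<open>even m\<close> closed by simp
  finally have "u (?g 0) = 0"
    using arcs m by (intro independentD[OF assms(3), of "?g ` {..<m}"]) force+
  then show False by (simp add: u_def)
qed

section \<open>Fractional edges and vertex-disjoint odd cycles\<close>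

text \<open>The edges at \<open>w\<close> correspond bijectively to its neighbours, and all other
  edge vectors vanish at \<open>w\<close>. Constant \<open>h\<close> gives degrees; the coefficients
  as \<open>h\<close> give the integrality condition at a vertex.\<close>

lemma incidence_sum:
  fixes D :: "('n::finite \<times> 'n) set" and h :: "(real ^ 'n) \<times> real \<Rightarrow> real"
  assumes "sym D" "irrefl D"
  shows "(\<Sum>e\<in>case_prod edge_vec ` D. h e * fst e $ w) = (\<Sum>j\<in>D `` {w}. h (edge_vec w j))"
proof -
  have irr: "i \<noteq> j" if "(i, j) \<in> D" for i j using assms(2) that by (auto simp: irrefl_def)
  have inj: "inj_on (edge_vec w) (D `` {w})"
    using irr by (auto intro!: inj_onI simp: edge_vec_eq_iff)
  have "(\<Sum>e\<in>case_prod edge_vec ` D. h e * fst e $ w)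
      = (\<Sum>e\<in>edge_vec w ` (D `` {w}). h e * fst e $ w)"
  proof (rule sum.mono_neutral_right)
    show "\<forall>e\<in>case_prod edge_vec ` D - edge_vec w ` (D `` {w}). h e * fst e $ w = 0"
    proof
      fix e assume e: "e \<in> case_prod edge_vec ` D - edge_vec w ` (D `` {w})"
      then obtain i j where ij: "(i, j) \<in> D" "e = edge_vec i j" by auto
      then have "(j, i) \<in> D" using assms(1) by (auto dest: symD)
      then have "i \<noteq> w" "j \<noteq> w" using e ij edge_vec_commute[of i j] by blast+
      then show "h e * fst e $ w = 0" using ij by (simp add: fst_edge_vec_nth)
    qed
  qed auto
  also have "\<dots> = (\<Sum>j\<in>D `` {w}. h (edge_vec w j) * fst (edge_vec w j) $ w)"
    by (simp add: sum.reindex[OF inj])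
  also have "\<dots> = (\<Sum>j\<in>D `` {w}. h (edge_vec w j))"
    by (intro sum.cong refl) (use irr in \<open>auto simp: fst_edge_vec_nth\<close>)
  finally show ?thesis .
qed

text \<open>The edge vectors lie in the span of one vector \<open>(axis i 1, 1/2)\<close> per
  vertex, so there are at most as many edges as vertices. The degrees sum to twice the number of
  edges, hence average at most 2, and none is below 2.\<close>

lemma two_regular_if_independent:
  fixes D :: "('n::finite \<times> 'n) set"
  assumes "sym D" "irrefl D" "independent (case_prod edge_vec ` D)"
    and deg: "\<And>w. w \<in> Domain D \<Longrightarrow> 2 \<le> card (D `` {w})" and w: "w \<in> Domain D"
  shows "card (D `` {w}) = 2"
proof -
  let ?F = "case_prod edge_vec ` D" and ?V = "Domain D"
  have "?F \<subseteq> span ((\<lambda>i. (axis i 1, 1/2)) ` ?V)"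
  proof
    fix e assume "e \<in> ?F"
    then obtain i j where ij: "(i, j) \<in> D" and e: "e = edge_vec i j" by auto
    then have "j \<in> ?V" "i \<in> ?V" using assms(1) by (auto dest: symD)
    then have "(axis i 1, 1/2) + (axis j 1, 1/2) \<in> span ((\<lambda>i. (axis i 1, 1/2 :: real)) ` ?V)"
      by (intro span_add span_base) auto
    then show "e \<in> span ((\<lambda>i. (axis i 1, 1/2)) ` ?V)"
      by (simp add: e edge_vec_def)
  qed
  then have "card ?F \<le> card ((\<lambda>i. (axis i 1, 1/2 :: real) :: (real ^ 'n) \<times> real) ` ?V)"
    using independent_span_bound[OF _ assms(3)] by simp
  also have "\<dots> \<le> card ?V" by (rule card_image_le) simp
  finally have le: "card ?F \<le> card ?V" .
  have "(\<Sum>w\<in>?V. real (card (D `` {w}))) = (\<Sum>w\<in>UNIV. real (card (D `` {w})))"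
    by (rule sum.mono_neutral_left) (auto simp: Image_def Domain_iff)
  also have "\<dots> = (\<Sum>w\<in>UNIV. \<Sum>e\<in>?F. fst e $ w)"
    using incidence_sum[OF assms(1,2), of "\<lambda>_. 1"] by simp
  also have "\<dots> = (\<Sum>e\<in>?F. \<Sum>w\<in>UNIV. fst e $ w)" by (rule sum.swap)
  also have "\<dots> = (\<Sum>e\<in>?F. 2)"
    by (intro sum.cong refl) (auto simp: fst_edge_vec_nth sum.distrib)
  also have "\<dots> \<le> (\<Sum>w\<in>?V. 2)" using le by simp
  finally have "(\<Sum>w\<in>?V. card (D `` {w})) \<le> (\<Sum>w\<in>?V. 2)"
    by (metis (mono_tags, lifting) of_nat_le_iff of_nat_sum of_nat_numeral sum.cong)
  moreover have "(\<Sum>w\<in>?V. 2) < (\<Sum>w\<in>?V. card (D `` {w}))" if "2 < card (D `` {w})"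
    by (rule sum_strict_mono_ex1) (use deg w that in auto)
  ultimately show ?thesis using deg[OF w] by fastforce
qed

text \<open>Modulo the integers, \<open>a i\<close> is \<open>(-1) ^ i * a 0\<close>, and closing up
  after an odd number of steps makes \<open>2 * a 0\<close> integral. This still allows every entry
  to be 1/2; the total, an odd number of terms congruent to \<open>a 0\<close>, excludes it.\<close>

lemma Ints_if_odd_cycle_sums:
  fixes a :: "nat \<Rightarrow> real"
  assumes "odd m" "\<And>i. Suc i < m \<Longrightarrow> a i + a (Suc i) \<in> \<int>" "a (m - 1) + a 0 \<in> \<int>"
    and total: "(\<Sum>i<m. a i) \<in> \<int>"
  shows "a 0 \<in> \<int>"
proof -
  have alt: "a i - (-1) ^ i * a 0 \<in> \<int>" if "i < m" for i
    using that
  proof (induction i)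
    case (Suc i)
    have "a i + a (Suc i) - (a i - (-1) ^ i * a 0) \<in> \<int>"
      by (intro Ints_diff[OF assms(2)] Suc) (use Suc.prems in auto)
    then show ?case by simp
  qed simp
  have "m > 0" using assms(1) by (cases m) auto
  then have "a (m - 1) - a 0 \<in> \<int>" using alt[of "m - 1"] assms(1) by simp
  from Ints_diff[OF assms(3) this] have two: "2 * a 0 \<in> \<int>" by simp
  have "a i - a 0 \<in> \<int>" if "i < m" for i
  proof (cases "even i")
    case False
    then show ?thesis using Ints_diff[OF alt[OF that] two] by simp
  qed (use alt[OF that] in simp)
  then have "(\<Sum>i<m. a i - a 0) \<in> \<int>" by (intro Ints_sum) auto
  then have "(\<Sum>i<m. a i) - real m * a 0 \<in> \<int>" by (simp add: sum_subtractf)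
  from Ints_diff[OF total this] have "real m * a 0 \<in> \<int>" by simp
  moreover obtain k where "m = 2 * k + 1" using assms(1) by (elim oddE)
  ultimately have "a 0 + real k * (2 * a 0) \<in> \<int>" by (simp add: algebra_simps)
  moreover have "real k * (2 * a 0) \<in> \<int>" by (rule Ints_mult[OF _ two]) simp
  ultimately show ?thesis by (metis Ints_diff add_diff_cancel_right')
qed

text \<open>
  By a dimension count the edges whose coefficients are not integral form a 2-regular graph, hence
  vertex-disjoint cycles, which are odd by independence.
\<close>

lemma no_fractional_edges:
  fixes D :: "('n::finite \<times> 'n) set" and c :: "(real ^ 'n) \<times> real \<Rightarrow> real"
  assumes "sym D" "irrefl D" and indep: "independent (case_prod edge_vec ` D)"
    and frac: "\<And>e. e \<in> case_prod edge_vec ` D \<Longrightarrow> c e \<notin> \<int>"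
    and vertex: "\<And>w. (\<Sum>e\<in>case_prod edge_vec ` D. c e * fst e $ w) \<in> \<int>"
    and total: "(\<Sum>e\<in>case_prod edge_vec ` D. c e) \<in> \<int>"
    and no_disj: "\<And>m f m' f'. simple_cycle D m f \<Longrightarrow> simple_cycle D m' f' \<Longrightarrow> odd m \<Longrightarrow> odd m' \<Longrightarrow>
      f ` {..<m} \<inter> f' ` {..<m'} \<noteq> {}"
  shows "D = {}"
proof (rule ccontr)
  assume "D \<noteq> {}"
  have symD': "(j, i) \<in> D" if "(i, j) \<in> D" for i j using assms(1) that by (auto dest: symD)
  have nb: "(\<Sum>j\<in>D `` {w}. c (edge_vec w j)) \<in> \<int>" for w
    using vertex[of w] incidence_sum[OF assms(1,2), of c w] by simp
  \<comment> \<open>At a vertex with a single fractional edge, the integrality condition would make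
    the coefficient of that edge an integer.\<close>
  have deg: "2 \<le> card (D `` {w})" if w: "w \<in> Domain D" for w
  proof (rule ccontr)
    assume "\<not> 2 \<le> card (D `` {w})"
    moreover obtain j where j: "(w, j) \<in> D" using w by auto
    then have "card (D `` {w}) \<noteq> 0" by auto
    ultimately have "card (D `` {w}) = 1" by linarith
    then have "D `` {w} = {j}" using j by (metis card_1_singletonE Image_singleton_iff singletonD)
    then have "c (edge_vec w j) \<in> \<int>" using nb[of w] by simp
    then show False using frac[of "edge_vec w j"] j by force
  qed
  have card2: "card (D `` {w}) = 2" if "w \<in> Domain D" for w
    using two_regular_if_independent[OF assms(1-3) deg that] .
  have step: "\<exists>j. j \<noteq> u \<and> (w, j) \<in> D" if "(u, w) \<in> D" for u w
  proof (rule ccontr)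
    assume "\<not> ?thesis"
    then have "D `` {w} \<subseteq> {u}" by auto
    then have "card (D `` {w}) \<le> card {u}" by (intro card_mono) auto
    then show False using card2[of w] symD'[OF that] by auto
  qed
  from simple_cycle_exists[OF \<open>D \<noteq> {}\<close> assms(2) step]
  obtain m f where cyc: "simple_cycle D m f" by blast
  have m: "3 \<le> m" and inj: "\<And>i j. i < m \<Longrightarrow> j < m \<Longrightarrow> f i = f j \<Longrightarrow> i = j" and closed: "f m = f 0"
    and arcs: "\<And>i. i < m \<Longrightarrow> (f i, f (Suc i)) \<in> D"
    using cyc by (auto simp: simple_cycle_def inj_on_def)
  have "odd m" using odd_length_if_independent[OF cyc assms(2,3)] .
  let ?C = "f ` {..<m}"
  have nbs: "D `` {w} = {u, v}" if "(u, w) \<in> D" "(w, v) \<in> D" "u \<noteq> v" for u v w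
  proof -
    have "w \<in> Domain D" using that by auto
    then have "{u, v} = D `` {w}"
      by (intro card_subset_eq) (use that symD' card2[of w] in auto)
    then show ?thesis by simp
  qed
  have nb_inner: "D `` {f (Suc i)} = {f i, f (Suc (Suc i))}" and ne_inner: "f i \<noteq> f (Suc (Suc i))"
    if "Suc i < m" for i
  proof -
    show ne: "f i \<noteq> f (Suc (Suc i))"
    proof (cases "Suc (Suc i) = m")
      case True
      then show ?thesis using inj[of i 0] closed m by auto
    next
      case False
      then show ?thesis using inj[of i "Suc (Suc i)"] that by auto
    qed
    show "D `` {f (Suc i)} = {f i, f (Suc (Suc i))}"
      by (rule nbs) (use arcs[of i] arcs[of "Suc i"] that ne in auto)
  qed
  have ne_outer: "f (m - 1) \<noteq> f 1" using inj[of "m - 1" 1] m by auto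
  have nb_outer: "D `` {f 0} = {f (m - 1), f 1}"
    by (rule nbs) (use arcs[of "m - 1"] arcs[of 0] m closed ne_outer in auto)
  \<comment> \<open>In degree 2 the neighbours of a cycle vertex are its predecessor and successor,
    so the cycle is a whole connected component.\<close>
  have nb_C: "D `` {w} \<subseteq> ?C" if w: "w \<in> ?C" for w
  proof -
    obtain i where i: "i < m" "w = f i" using w by auto
    show ?thesis
    proof (cases i)
      case 0
      then show ?thesis using nb_outer i m by auto
    next
      case (Suc k)
      have "f (Suc (Suc k)) \<in> ?C"
      proof (cases "Suc (Suc k) = m")
        case True
        then show ?thesis using closed m by auto
      next
        case False
        then show ?thesis using i Suc by (intro imageI) auto
      qed
      then show ?thesis using nb_inner[of k] i Suc by auto
    qed
  qed
  \<comment> \<open>Edges off the first cycle could again be followed without backtracking, and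
    would contain a second cycle, odd by independence and disjoint from the first.\<close>
  define D' where "D' = {(u, w) \<in> D. u \<notin> ?C}"
  have "D' = {}"
  proof (rule ccontr)
    assume "D' \<noteq> {}"
    moreover have "irrefl D'" using assms(2) by (auto simp: D'_def irrefl_def)
    moreover have "\<exists>j. j \<noteq> u \<and> (w, j) \<in> D'" if "(u, w) \<in> D'" for u w
    proof -
      have "w \<notin> ?C" using that nb_C[of w] symD'[of u w] by (auto simp: D'_def)
      then show ?thesis using that step[of u w] by (auto simp: D'_def)
    qed
    ultimately obtain m' f' where cyc': "simple_cycle D' m' f'" using simple_cycle_exists by blast
    have cycD: "simple_cycle D m' f'" by (rule simple_cycle_mono[OF cyc']) (auto simp: D'_def)
    then have "odd m'" using odd_length_if_independent assms(2,3) by blast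
    moreover have "f' i \<notin> ?C" if "i < m'" for i
    proof -
      have "(f' i, f' (Suc i)) \<in> D'" using cyc' that by (simp add: simple_cycle_def)
      then show ?thesis by (simp add: D'_def)
    qed
    then have "f' ` {..<m'} \<subseteq> - ?C" by (intro image_subsetI) simp
    then have "?C \<inter> f' ` {..<m'} = {}" by blast
    ultimately show False using no_disj[OF cyc cycD \<open>odd m\<close>] by simp
  qed
  define g where "g i = edge_vec (f i) (f (Suc i))" for i
  have F: "case_prod edge_vec ` D = g ` {..<m}"
  proof (intro equalityI subsetI)
    fix e assume "e \<in> case_prod edge_vec ` D"
    then obtain u w where uw: "(u, w) \<in> D" "e = edge_vec u w" by auto
    then have "u \<in> ?C" using \<open>D' = {}\<close> by (auto simp: D'_def)
    then obtain i where i: "i < m" "u = f i" by auto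
    show "e \<in> g ` {..<m}"
    proof (cases i)
      case 0
      then have "w = f (m - 1) \<or> w = f 1" using nb_outer uw i by auto
      then have "e = g (m - 1) \<or> e = g 0"
        using uw i 0 m closed by (auto simp: g_def edge_vec_commute)
      then show ?thesis using m by auto
    next
      case (Suc k)
      then have "w = f k \<or> w = f (Suc (Suc k))" using nb_inner[of k] uw i by auto
      then have "e = g k \<or> e = g (Suc k)" using uw i Suc by (auto simp: g_def edge_vec_commute)
      then show ?thesis using i Suc by auto
    qed
  next
    fix e assume "e \<in> g ` {..<m}"
    then show "e \<in> case_prod edge_vec ` D" using arcs by (force simp: g_def)
  qed
  have inj_g: "inj_on g {..<m}" using inj_on_cycle_edges[OF cyc assms(2)] by (simp add: g_def[abs_def])
  \<comment> \<open>All edges lie on one odd cycle. The conditions at its vertices are the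
    consecutive sums, and the condition on the height coordinate is the total.\<close>
  have "c (g 0) \<in> \<int>"
  proof (rule Ints_if_odd_cycle_sums[OF \<open>odd m\<close>, of "c \<circ> g", simplified comp_def])
    show "(\<Sum>i<m. c (g i)) \<in> \<int>" using total unfolding F by (simp add: sum.reindex[OF inj_g])
    show "c (g i) + c (g (Suc i)) \<in> \<int>" if "Suc i < m" for i
      using nb[of "f (Suc i)"] nb_inner[OF that] ne_inner[OF that]
      by (simp add: g_def edge_vec_commute[of "f i"])
    show "c (g (m - 1)) + c (g 0) \<in> \<int>"
      using nb[of "f 0"] nb_outer ne_outer m closed
      by (simp add: g_def edge_vec_commute[of "f (m - Suc 0)"])
  qed
  then show False using frac[of "g 0"] F m by auto
qed

section \<open>Edge polytopes\<close>

lemma edge_vec_in_int_lattice: "edge_vec i j \<in> int_lattice"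
  by (auto simp: int_lattice_prod_iff fst_edge_vec_nth) (simp add: edge_vec_def)

text \<open>Products with a point and negation commute with convex hulls, so each layer is the hull
  of lifted edge vectors up to sign.\<close>

lemma Omega_edge_polytope_eq:
  "Omega_polytope (edge_polytope G) (edge_polytope G) =
     convex hull (case_prod edge_vec ` parcs G \<union> uminus ` case_prod edge_vec ` parcs G)"
proof -
  let ?A = "{axis i 1 + axis j 1 | i j. (i, j) \<in> parcs G} :: (real ^ 'a) set"
  let ?E = "case_prod edge_vec ` parcs G"
  have "edge_polytope G \<times> {1} = convex hull (?A \<times> {1 :: real})"
    by (simp add: edge_polytope_def convex_hull_Times)
  also have "?A \<times> {1} = ?E"
    by (intro equalityI subsetI) (force simp: edge_vec_def)+
  finally have pos: "edge_polytope G \<times> {1} = convex hull ?E" .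
  have "uminus ` edge_polytope G \<times> {-1} = uminus ` (edge_polytope G \<times> {1 :: real})"
    by (force simp: image_iff)
  also have "\<dots> = convex hull (uminus ` ?E)"
    unfolding pos by (rule convex_hull_linear_image) (simp add: linear_uminus)
  finally have neg: "uminus ` edge_polytope G \<times> {-1} = convex hull (uminus ` ?E)" .
  show ?thesis
    unfolding Omega_polytope_def pos neg by (rule hull_Un[symmetric]) (simp add: convex_Inter)
qed

text \<open>
  Subtracting the integral part leaves a combination of the vectors with fractional coefficients.
\<close>

lemma edge_vecs_unimodular:
  fixes G :: "'n::finite pair_pre_digraph"
  assumes G: "pair_graph G"
    and no_disj: "\<not> (\<exists>p q. odd_cycle G p \<and> odd_cycle G q \<and> cycle_verts p \<inter> cycle_verts q = {})"
    and F: "F \<subseteq> case_prod edge_vec ` parcs G" "independent F"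
    and int: "(\<Sum>f\<in>F. c f *\<^sub>R f) \<in> int_lattice" and "f \<in> F"
  shows "c f \<in> \<int>"
proof -
  interpret pair_graph G by fact
  define F' where "F' = {f \<in> F. c f \<notin> \<int>}"
  define D where "D = {(i, j) \<in> parcs G. edge_vec i j \<in> F'}"
  have finF: "finite F" using F(1) by (rule finite_subset) simp
  have D: "case_prod edge_vec ` D = F'"
    using F(1) by (force simp: D_def F'_def)
  have eq: "(\<Sum>f\<in>F'. c f *\<^sub>R f) = (\<Sum>f\<in>F. c f *\<^sub>R f) - (\<Sum>f\<in>F - F'. c f *\<^sub>R f)"
    using finF by (subst sum.subset_diff[of F' F]) (auto simp: F'_def)
  have "case_prod edge_vec ` parcs G \<subseteq> int_lattice" using edge_vec_in_int_lattice by auto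
  then have "F \<subseteq> int_lattice" using F(1) by blast
  then have "(\<Sum>f\<in>F. c f *\<^sub>R f) - (\<Sum>f\<in>F - F'. c f *\<^sub>R f) \<in> int_lattice"
    by (intro int_lattice_diff int int_lattice_sum int_lattice_scaleR) (auto simp: F'_def)
  then have int': "(\<Sum>f\<in>F'. c f *\<^sub>R f) \<in> int_lattice" unfolding eq .
  have "D = {}"
  proof (rule no_fractional_edges)
    show "sym D"
      using pair_sym_arcs by (auto simp: D_def sym_def symmetric_def edge_vec_commute)
    show "irrefl D" using pair_no_loops by (force simp: D_def irrefl_def)
    show "independent (case_prod edge_vec ` D)"
      unfolding D by (rule independent_mono[OF F(2)]) (auto simp: F'_def)
    show "c e \<notin> \<int>" if "e \<in> case_prod edge_vec ` D" for e
      using that unfolding D by (simp add: F'_def)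
    show "(\<Sum>e\<in>case_prod edge_vec ` D. c e * fst e $ w) \<in> \<int>" for w
      using int' unfolding D int_lattice_prod_iff by (simp add: fst_sum)
    have "snd f = 1" if "f \<in> F'" for f
      using that F(1) by (auto simp: F'_def edge_vec_def)
    then have "snd (\<Sum>f\<in>F'. c f *\<^sub>R f) = (\<Sum>e\<in>F'. c e)" by (simp add: snd_sum)
    then show "(\<Sum>e\<in>case_prod edge_vec ` D. c e) \<in> \<int>"
      using int' unfolding D int_lattice_prod_iff by simp
  next
    fix m f m' f'
    assume cyc: "simple_cycle D m f" "simple_cycle D m' f'" and odd: "odd m" "odd m'"
    have "D \<subseteq> parcs G" by (auto simp: D_def)
    with cyc obtain p q where "odd_cycle G p" "cycle_verts p = f ` {..<m}"
      "odd_cycle G q" "cycle_verts q = f' ` {..<m'}"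
      using odd_cycle_of_simple_cycle[OF _ _ G] odd simple_cycle_mono by metis
    then show "f ` {..<m} \<inter> f' ` {..<m'} \<noteq> {}" using no_disj by metis
  qed
  then have "F' = {}" using D by auto
  then show ?thesis using \<open>f \<in> F\<close> unfolding F'_def by blast
qed

section \<open>Lattice points of the edge hull\<close>

text \<open>At height 1 the l1-bound is attained, so all coefficients are nonnegative. At an
  endpoint of a used edge \<open>e0\<close> the coordinate is positive and integral, hence at least
  1, which forces every used edge to contain that endpoint. So only \<open>e0\<close> is
  used.\<close>

lemma lattice_point_at_height_1:
  fixes E :: "((real ^ 'n::finite) \<times> real) set"
  assumes "finite E" "E \<subseteq> case_prod edge_vec ` {(i, j). i \<noteq> j}"
    and x: "x = (\<Sum>e\<in>E. c e *\<^sub>R e)" "(\<Sum>e\<in>E. \<bar>c e\<bar>) \<le> 1" "x \<in> int_lattice" "snd x = 1"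
  shows "x \<in> E"
proof -
  have snd1: "snd e = 1" if "e \<in> E" for e using assms(2) that by (auto simp: edge_vec_def)
  have coord: "fst e $ w = 0 \<or> fst e $ w = 1" if "e \<in> E" for e w
  proof -
    obtain i j where "i \<noteq> j" "e = edge_vec i j" using assms(2) \<open>e \<in> E\<close> by auto
    then show ?thesis by (auto simp: fst_edge_vec_nth)
  qed
  have sum1: "(\<Sum>e\<in>E. c e) = 1" using x(1,4) snd1 by (simp add: snd_sum)
  have "(\<Sum>e\<in>E. \<bar>c e\<bar> - c e) \<le> 0" using x(2) sum1 by (simp add: sum_subtractf)
  then have "(\<Sum>e\<in>E. \<bar>c e\<bar> - c e) = 0" by (intro antisym sum_nonneg) auto
  then have "\<forall>e\<in>E. \<bar>c e\<bar> - c e = 0" using assms(1) by (subst (asm) sum_nonneg_eq_0_iff) auto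
  then have c: "c e \<ge> 0" if "e \<in> E" for e using that by force
  obtain e0 where e0: "e0 \<in> E" "c e0 \<noteq> 0" using sum1 by (metis sum.neutral zero_neq_one)
  then obtain i j where ij: "i \<noteq> j" "e0 = edge_vec i j" using assms(2) by auto
  have full: "fst e $ w = 1" if w: "fst e0 $ w = 1" and e: "e \<in> E" "c e \<noteq> 0" for w e
  proof -
    have xw: "fst x $ w = (\<Sum>e\<in>E. c e * fst e $ w)" by (simp add: x(1) fst_sum)
    have nonneg: "0 \<le> c e * fst e $ w" "0 \<le> c e * (1 - fst e $ w)" if "e \<in> E" for e
      using c[OF that] coord[OF that, of w] by auto
    have "0 < c e0 * fst e0 $ w" using w c[OF e0(1)] e0(2) by simp
    also have "\<dots> \<le> fst x $ w"
      unfolding xw using assms(1) e0(1) nonneg(1) by (intro member_le_sum) auto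
    finally have "fst x $ w \<ge> 1"
      using x(3) by (auto simp: int_lattice_prod_iff elim!: Ints_cases dest!: spec[of _ w])
    then have "(\<Sum>e\<in>E. c e * (1 - fst e $ w)) \<le> 0"
      using sum1 xw by (simp add: algebra_simps sum_subtractf)
    then have "(\<Sum>e\<in>E. c e * (1 - fst e $ w)) = 0"
      using nonneg(2) by (intro antisym sum_nonneg) auto
    then have "c e * (1 - fst e $ w) = 0"
      using assms(1) nonneg(2) e(1) by (simp add: sum_nonneg_eq_0_iff)
    then show ?thesis using e(2) by simp
  qed
  have "c e = 0" if e: "e \<in> E" "e \<noteq> e0" for e
  proof (rule ccontr)
    assume "c e \<noteq> 0"
    obtain k l where kl: "k \<noteq> l" "e = edge_vec k l" using assms(2) e by auto
    have "fst e $ i = 1" "fst e $ j = 1"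
      using full[OF _ e(1) \<open>c e \<noteq> 0\<close>] ij by (auto simp: fst_edge_vec_nth)
    then have "e = e0" using kl ij by (auto simp: fst_edge_vec_nth edge_vec_eq_iff split: if_splits)
    then show False using e by simp
  qed
  then have "(\<Sum>e\<in>E. c e *\<^sub>R e) = c e0 *\<^sub>R e0" "(\<Sum>e\<in>E. c e) = c e0"
    using assms(1) e0(1) by (simp_all add: sum.remove[of E e0])
  then show ?thesis using x(1) sum1 e0(1) by simp
qed

text \<open>Integrality leaves the heights -1, 0 and 1. The outer two are settled by
  \<open>lattice_point_at_height_1\<close> and symmetry; at height 0 every coordinate is at most 1/2
  in absolute value, hence 0.\<close>

lemma lattice_points_edge_hull:
  fixes E :: "((real ^ 'n::finite) \<times> real) set"
  assumes "finite E" "E \<noteq> {}" "E \<subseteq> case_prod edge_vec ` {(i, j). i \<noteq> j}"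
    and "x \<in> convex hull (E \<union> uminus ` E)" and int: "x \<in> int_lattice"
  shows "x \<in> insert 0 (E \<union> uminus ` E)"
proof -
  obtain c where c: "x = (\<Sum>e\<in>E. c e *\<^sub>R e)" "(\<Sum>e\<in>E. \<bar>c e\<bar>) \<le> 1"
    using assms(4) convex_hull_Un_uminus_eq[OF assms(1,2)] by auto
  have snd1: "snd e = 1" if "e \<in> E" for e using assms(3) that by (auto simp: edge_vec_def)
  have height: "snd x = (\<Sum>e\<in>E. c e)" using snd1 by (simp add: c(1) snd_sum)
  have "\<bar>snd x\<bar> \<le> 1" using c(2) sum_abs[of c E] unfolding height by linarith
  moreover obtain t where t: "snd x = of_int t"
    using int by (auto simp: int_lattice_prod_iff elim: Ints_cases)
  ultimately have "\<bar>t\<bar> \<le> 1" by linarith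
  then consider "snd x = 1" | "snd x = -1" | "snd x = 0" using t by fastforce
  then show ?thesis
  proof cases
    case 1
    then show ?thesis using lattice_point_at_height_1[OF assms(1,3) c int] by simp
  next
    case 2
    have "- x \<in> E"
      by (rule lattice_point_at_height_1[OF assms(1,3), of _ "\<lambda>e. - c e"])
        (use c 2 int_lattice_minus[OF int] in \<open>auto simp: sum_negf\<close>)
    then show ?thesis by force
  next
    case 3
    have "fst x $ w = 0" for w
    proof -
      \<comment> \<open>Subtracting the height turns the coordinates 0 and 1 of edge vectors into -1
        and 1, so that the l1-bound limits \<open>2 * fst x $ w\<close> to 1.\<close>
      have "2 * (fst x $ w) = 2 * (fst x $ w) - snd x" using 3 by simp
      also have "\<dots> = (\<Sum>e\<in>E. c e * (2 * fst e $ w - 1))"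
        unfolding height by (simp add: c(1) fst_sum algebra_simps sum_subtractf sum_distrib_left)
      finally have eq: "2 * (fst x $ w) = (\<Sum>e\<in>E. c e * (2 * fst e $ w - 1))" .
      have "\<bar>2 * fst e $ w - 1\<bar> = 1" if "e \<in> E" for e
      proof -
        obtain i j where "i \<noteq> j" "e = edge_vec i j" using assms(3) \<open>e \<in> E\<close> by auto
        then show ?thesis by (auto simp: fst_edge_vec_nth)
      qed
      then have "(\<Sum>e\<in>E. \<bar>c e * (2 * fst e $ w - 1)\<bar>) = (\<Sum>e\<in>E. \<bar>c e\<bar>)"
        by (intro sum.cong refl) (simp add: abs_mult)
      then have "\<bar>2 * (fst x $ w)\<bar> \<le> 1"
        unfolding eq using c(2) sum_abs[of "\<lambda>e. c e * (2 * fst e $ w - 1)" E] by linarith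
      then have "\<bar>fst x $ w\<bar> < 1" by simp
      moreover have "fst x $ w \<in> \<int>" using int by (simp add: int_lattice_prod_iff)
      ultimately show ?thesis using Ints_nonzero_abs_less1 by blast
    qed
    then have "x = 0" using 3 by (simp add: prod_eq_iff vec_eq_iff)
    then show ?thesis by simp
  qed
qed

section \<open>The obstruction from two disjoint odd cycles\<close>

text \<open>Each arc contributes twice the vector of its tail plus head minus tail, and the
  differences telescope. On a closed walk the two correction terms cancel.\<close>

lemma sum_list_edge_vec_walk:
  "pcas u p v \<Longrightarrow> (\<Sum>a\<leftarrow>p. case_prod edge_vec a) + (axis u 1, 0) =
    2 *\<^sub>R (\<Sum>a\<leftarrow>p. (axis (fst a) 1, 1/2)) + (axis v 1, 0)"
proof (induction u p v rule: pcas.induct)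
  case (2 u e es v)
  then show ?case by (auto simp: edge_vec_def prod_eq_iff scaleR_2 algebra_simps split: prod.splits)
qed simp

lemma sum_list_scaled_in_convex:
  fixes xs :: "'a::real_vector list"
  assumes "xs \<noteq> []" "set xs \<subseteq> K" "convex K"
  shows "(1 / real (length xs)) *\<^sub>R sum_list xs \<in> K"
proof -
  have "(\<Sum>i<length xs. (1 / real (length xs)) *\<^sub>R xs ! i) \<in> K"
    by (rule convex_sum) (use assms in auto)
  then show ?thesis by (simp add: sum_list_sum_nth atLeast0LessThan scaleR_sum_right)
qed

lemma not_normal_if_disjoint_odd_cycles:
  fixes G :: "'n::finite pair_pre_digraph"
  assumes G: "pair_graph G" and p: "odd_cycle G p" and q: "odd_cycle G q"
    and disj: "cycle_verts p \<inter> cycle_verts q = {}"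
  shows "\<not> normal_polytope (Omega_polytope (edge_polytope G) (edge_polytope G))"
proof
  interpret pair_graph G by fact
  let ?E = "case_prod edge_vec ` parcs G"
  let ?\<Omega> = "convex hull (?E \<union> uminus ` ?E)"
  assume "normal_polytope (Omega_polytope (edge_polytope G) (edge_polytope G))"
  then have normal: "normal_polytope ?\<Omega>" by (simp add: Omega_edge_polytope_eq)
  have pq: "set p \<subseteq> parcs G" "set q \<subseteq> parcs G" "odd (length p)" "odd (length q)"
    and closed: "\<exists>u. pcas u p u" "\<exists>u. pcas u q u"
    using p q by (auto simp: odd_cycle_def cycle_def awalk_def)
  have "p \<noteq> []" using pq(3) by auto
  have finE: "finite ?E" and neE: "?E \<noteq> {}" using pq \<open>p \<noteq> []\<close> by auto
  have intE: "?E \<subseteq> int_lattice" using edge_vec_in_int_lattice by auto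
  have loopless: "?E \<subseteq> case_prod edge_vec ` {(i, j). i \<noteq> j}" using pair_no_loops by force
  define h :: "('n \<times> 'n) list \<Rightarrow> (real ^ 'n) \<times> real"
    where "h r = (\<Sum>a\<leftarrow>r. (axis (fst a) 1, 1/2))" for r
  have h: "(\<Sum>a\<leftarrow>r. case_prod edge_vec a) = 2 *\<^sub>R h r" if "\<exists>u. pcas u r u" for r
    using that sum_list_edge_vec_walk unfolding h_def by (metis add_right_cancel)
  \<comment> \<open>On a closed walk \<open>h\<close> is half the sum of the edge vectors. So
    \<open>X\<close> is half the sum of the \<open>2 * N\<close> generators in \<open>?zs\<close>,
    which is \<open>N\<close> times their average.\<close>
  define X where "X = h p - h q"
  let ?zs = "map (case_prod edge_vec) p @ map (\<lambda>a. - case_prod edge_vec a) q"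
  obtain N where N: "length p + length q = 2 * N" using pq(3,4) by (metis evenE odd_even_add)
  have "N > 0" using N \<open>p \<noteq> []\<close> by (cases N) auto
  have "(\<Sum>a\<leftarrow>q. - case_prod edge_vec a) = - (\<Sum>a\<leftarrow>q. case_prod edge_vec a)"
    by (induction q) auto
  then have "sum_list ?zs = 2 *\<^sub>R X"
    using h closed by (simp add: X_def scaleR_diff_right)
  moreover have "(1 / real (length ?zs)) *\<^sub>R sum_list ?zs \<in> ?\<Omega>"
  proof (rule sum_list_scaled_in_convex)
    have "set ?zs = case_prod edge_vec ` set p \<union> uminus ` case_prod edge_vec ` set q"
      by (simp add: image_image)
    also have "\<dots> \<subseteq> ?E \<union> uminus ` ?E" using pq by (intro Un_mono image_mono)
    finally have "set ?zs \<subseteq> ?E \<union> uminus ` ?E" .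
    then show "set ?zs \<subseteq> ?\<Omega>" using hull_subset[of "?E \<union> uminus ` ?E" convex] by blast
  qed (use \<open>p \<noteq> []\<close> in auto)
  ultimately have \<omega>: "(1 / real N) *\<^sub>R X \<in> ?\<Omega>" using N by (simp flip: of_nat_add)
  have fst_h: "fst (h r) $ w = real (count_list (map fst r) w)" for r w
    by (induction r) (auto simp: h_def axis_def)
  have snd_h: "snd (h r) = length r / 2" for r
    by (induction r) (auto simp: h_def add_divide_distrib)
  \<comment> \<open>The height is half the difference of the two lengths, an integer because both
    are odd.\<close>
  have "snd X = real_of_int (int (length p) - int N)"
    using N by (simp add: X_def snd_h field_simps flip: of_nat_add)
  then have "X \<in> int_lattice" by (simp add: int_lattice_prod_iff X_def fst_h)
  then obtain y where y: "\<And>i. i < N \<Longrightarrow> y i \<in> ?\<Omega> \<inter> int_lattice" "X = (\<Sum>i<N. y i)"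
    using integer_decomposition_if_normal[OF finE neE intE normal \<open>N > 0\<close> \<omega>] \<open>N > 0\<close> by auto
  text \<open>\<open>\<psi>\<close> is at most 2 on every lattice point of the polytope, with equality only for edges inside
    the first cycle and negated edges inside the second; on those, \<open>\<rho>\<close> is even.\<close>
  define s :: "'n \<Rightarrow> real"
    where "s w = (if w \<in> cycle_verts p then 1 else if w \<in> cycle_verts q then -1 else 0)" for w
  define \<psi> :: "(real ^ 'n) \<times> real \<Rightarrow> real" where "\<psi> z = (\<Sum>w\<in>UNIV. s w * fst z $ w)" for z
  define \<rho> :: "(real ^ 'n) \<times> real \<Rightarrow> real" where "\<rho> z = (\<Sum>w\<in>cycle_verts p. fst z $ w)" for z
  have \<psi>_edge: "\<psi> (edge_vec i j) = s i + s j" for i j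
    by (simp add: \<psi>_def fst_edge_vec_nth distrib_left sum.distrib if_distrib[of "times _"] cong: if_cong)
  have \<rho>_edge: "\<rho> (edge_vec i j) = of_bool (i \<in> cycle_verts p) + of_bool (j \<in> cycle_verts p)" for i j
    by (simp add: \<rho>_def fst_edge_vec_nth sum.distrib)
  have \<psi>_minus: "\<psi> (- z) = - \<psi> z" and \<rho>_minus: "\<rho> (- z) = - \<rho> z" for z
    by (simp_all add: \<psi>_def \<rho>_def sum_negf)
  have yi: "\<psi> (y i) \<le> 2 \<and> (\<psi> (y i) = 2 \<longrightarrow> \<rho> (y i) = 0 \<or> \<rho> (y i) = 2)" if "i < N" for i
  proof -
    have "y i \<in> insert 0 (?E \<union> uminus ` ?E)"
      using lattice_points_edge_hull[OF finE neE loopless] y(1)[OF that] by blast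
    then consider "y i = 0" | k l where "y i = edge_vec k l" | k l where "y i = - edge_vec k l"
      by auto
    then show ?thesis
    proof cases
      case 1
      then show ?thesis by (simp add: \<psi>_def)
    next
      case 2
      then show ?thesis by (auto simp: \<psi>_edge \<rho>_edge s_def)
    next
      case 3
      then show ?thesis using disj by (auto simp: \<psi>_edge \<rho>_edge \<psi>_minus \<rho>_minus s_def)
    qed
  qed
  have \<psi>_h: "\<psi> (h r) = (\<Sum>a\<leftarrow>r. s (fst a))" for r
    by (induction r) (auto simp: h_def \<psi>_def axis_def distrib_left sum.distrib if_distrib[of "times _"] cong: if_cong)
  have \<rho>_h: "\<rho> (h r) = (\<Sum>a\<leftarrow>r. of_bool (fst a \<in> cycle_verts p))" for r
    by (induction r) (auto simp: h_def \<rho>_def axis_def sum.distrib)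
  have in_p: "fst a \<in> cycle_verts p" if "a \<in> set p" for a using that by (simp add: cycle_verts_def)
  have in_q: "fst a \<in> cycle_verts q" if "a \<in> set q" for a using that by (simp add: cycle_verts_def)
  then have notin_p: "fst a \<notin> cycle_verts p" if "a \<in> set q" for a using that disj by blast
  have "(\<Sum>a\<leftarrow>p. s (fst a)) = (\<Sum>a\<leftarrow>p. 1)" "(\<Sum>a\<leftarrow>q. s (fst a)) = (\<Sum>a\<leftarrow>q. -1)"
    using in_p in_q notin_p by (auto intro!: arg_cong[of _ _ sum_list] map_cong simp: s_def)
  then have \<psi>_X: "\<psi> X = 2 * real N"
    using N \<psi>_h[of p] \<psi>_h[of q]
    by (simp add: X_def \<psi>_def right_diff_distrib sum_subtractf sum_list_triv flip: of_nat_add)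
  have "map (\<lambda>a. of_bool (fst a \<in> cycle_verts p)) p = map (\<lambda>_. 1 :: real) p"
    "map (\<lambda>a. of_bool (fst a \<in> cycle_verts p)) q = map (\<lambda>_. 0 :: real) q"
    using in_p notin_p by auto
  then have "\<rho> (h p) = real (length p)" "\<rho> (h q) = 0"
    unfolding \<rho>_h by (simp_all only: sum_list_triv)
  then have \<rho>_X: "\<rho> X = real (length p)" by (simp add: X_def \<rho>_def sum_subtractf)
  \<comment> \<open>\<open>X\<close> attains the bound \<open>2 * N\<close> for a sum of
    \<open>N\<close> lattice points, so every summand attains 2 and has even \<open>\<rho>\<close>.
    Then \<open>\<rho> X\<close>, the odd length of \<open>p\<close>, would be even.\<close>
  have "\<psi> X = (\<Sum>i<N. \<psi> (y i))"
    by (simp add: \<psi>_def y(2) fst_sum sum_distrib_left sum.swap[of _ UNIV])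
  then have "(\<Sum>i<N. 2 - \<psi> (y i)) = 0" using \<psi>_X by (simp add: sum_subtractf)
  then have "\<forall>i<N. 2 - \<psi> (y i) = 0" using yi by (subst (asm) sum_nonneg_eq_0_iff) auto
  then have \<rho>_y: "\<rho> (y i) = 2 * of_bool (\<rho> (y i) = 2)" if "i < N" for i using yi[OF that] that by auto
  have "\<rho> X = (\<Sum>i<N. \<rho> (y i))"
    by (simp add: \<rho>_def y(2) fst_sum sum.swap[of _ "cycle_verts p"])
  also have "\<dots> = (\<Sum>i<N. 2 * of_bool (\<rho> (y i) = 2))" by (intro sum.cong refl \<rho>_y) simp
  also have "\<dots> = real (2 * (\<Sum>i<N. of_bool (\<rho> (y i) = 2)))" by (simp add: sum_distrib_left)
  finally have "length p = 2 * (\<Sum>i<N. of_bool (\<rho> (y i) = 2))" unfolding \<rho>_X of_nat_eq_iff .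
  then show False using pq(3) by simp
qed

theorem theorem3p2:
  fixes G :: "'n::finite pair_pre_digraph"
  assumes "finite_simple_graph G"
    and "pverts G = UNIV"
    and "Digraph_Component.connected (with_proj G)"
  shows "normal_polytope (Omega_polytope (edge_polytope G) (edge_polytope G)) \<longleftrightarrow>
    \<not> (\<exists>p q. odd_cycle G p \<and> odd_cycle G q \<and> cycle_verts p \<inter> cycle_verts q = {})"
proof
  have G: "pair_graph G" using assms(1) by (simp add: finite_simple_graph_def)
  let ?E = "case_prod edge_vec ` parcs G"
  have finE: "finite ?E" by simp
  \<comment> \<open>The vertex type is nonempty and no vertex is isolated.\<close>
  have neE: "?E \<noteq> {}" using assms(1,2) by (auto simp: finite_simple_graph_def)
  have intE: "?E \<subseteq> int_lattice" using edge_vec_in_int_lattice by auto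
  show "\<not> (\<exists>p q. odd_cycle G p \<and> odd_cycle G q \<and> cycle_verts p \<inter> cycle_verts q = {})"
    if normal: "normal_polytope (Omega_polytope (edge_polytope G) (edge_polytope G))"
  proof (intro notI, elim exE conjE)
    fix p q assume "odd_cycle G p" "odd_cycle G q" "cycle_verts p \<inter> cycle_verts q = {}"
    then show False by (rule notE[OF not_normal_if_disjoint_odd_cycles[OF G] normal])
  qed
  show "normal_polytope (Omega_polytope (edge_polytope G) (edge_polytope G))"
    if no_disj: "\<not> (\<exists>p q. odd_cycle G p \<and> odd_cycle G q \<and> cycle_verts p \<inter> cycle_verts q = {})"
    unfolding Omega_edge_polytope_eq
  proof (rule normal_polytope_if_unimodular[OF finE neE intE])
    show "c f \<in> \<int>" if "F \<subseteq> ?E" "independent F" "(\<Sum>f\<in>F. c f *\<^sub>R f) \<in> int_lattice" "f \<in> F"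
      for F c f
      using edge_vecs_unimodular[OF G no_disj that] .
  qed
qed

end
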